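(* Let $m\ge 1$ be an odd integer. The function $\mathsf{Ft}\left[\exp(z^2/2)/z,1\right](x)$ equals, up to a (nonzero real) multiplicative constant, \[\frac{\overline x}{|x|^{m+1}}+\mathsf{M}(x),\] where $\mathsf{M}$ is an entire two-sided monogenic function, i.e. $\mathsf M:\mathbb R^{m+1}\to\mathbb R_{0,m}$ satisfies $\partial_x\mathsf M=\mathsf M\partial_x=0$ on all of $\mathbb R^{m+1}$. Moreover, for all $K,R>0$ there is a constant $C>0$ depending on $K$ and $R$ such that, for $|x_0|\le K$ and $r\ge R$, \[\bigl|\mathsf{Ft}\left[\exp(z^2/2)/z,1\right](x)\bigr|\le C\exp\left(-r^2/2\right).\]
   Context: $\mathbb R_{0,m}$ is the real Clifford algebra (associative, unital, of dimension $2^m$) generated by an orthonormal basis $e_1,\dots,e_m$ of $\mathbb R^m$ with $e_j^2=-1$ and $e_je_k+e_ke_j=0$ for $j\neq k$. It has the basis $e_A=e_{j_1}\cdots e_{j_k}$, for $A=\{j_1<\dots<j_k\}\subset\{1,\dots,m\}$, with $e_\emptyset=1$. For $a=\sum_A a_Ae_A$ with $a_A\in\mathbb R$, the norm is $|a|=\left(\sum_A a_A^2\right)^{1/2}$ and the conjugate is $\overline a=\sum_A a_A\overline{e}_A$, where $\overline e_A=(-1)^{k(k+1)/2}e_A$ for $|A|=k$. A point $(x_1,\dots,x_m)\in\mathbb R^m$ is identified with $\underline x=\sum_{j=1}^m x_je_j$, and $(x_0,x_1,\dots,x_m)\in\mathbb R^{m+1}$ with the paravector $x=x_0+\underline x\in\mathbb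 R_{0,m}$; thus $\overline x=x_0-\underline x$ and $|x|$ is the Euclidean norm. Put $r=|\underline x|$ and $\underline\omega=\underline x/r$ for $\underline x\neq0$. The Dirac operator is $\partial_{\underline x}=\sum_{j=1}^m e_j\partial_{x_j}$, the generalized Cauchy-Riemann operator is $\partial_x=\partial_{x_0}+\partial_{\underline x}$, and $\Delta_x=\sum_{j=0}^m\partial_{x_j}^2$. A continuously differentiable $\mathbb R_{0,m}$-valued function $f$ on an open subset of $\mathbb R^{m+1}$ is left monogenic if $\partial_xf=\partial_{x_0}f+\sum_{j=1}^m e_j\,\partial_{x_j}f=0$, right monogenic if $f\partial_x=\partial_{x_0}f+\sum_{j=1}^m(\partial_{x_j}f)\,e_j=0$, and two-sided monogenic if both hold. Entire means defined and monogenic on all of $\mathbb R^{m+1}$. For $m$ odd and $f(z)=u(x,y)+iv(x,y)$ ($z=x+iy$, with $u,v$ real-valued) holomorphic in the upper half-plane $\{y>0\}$, define, for $x\in\mathbb R^{m+1}$ with $\underline x\neq0$, \[\mathsf{Ft}\left[f(z),1\right](x)=\Delta_x^{\frac{m-1}{2}}\bigl[u(x_0,r)+\underline\omega\,v(x_0,r)\bigr].\] In particular, for $f(z)=\exp(z^2/2)/z$ one has \[u(x,y)=\frac{\exp\left(\frac{x^2-y^2}{2}\right)}{x^2+y^2}\bigl(x\cos(xy)+y\sin(xy)\bigr),\qquad v(x,y)=\frac{\exp\left(\frac{x^2-y^2}{2}\right)}{x^2+y^2}\bigl(x\sin(xy)-y\cos(xy)\bigr).\] The first assertion of the claim is an identity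 for $x$ with $\underline x\neq 0$, where $\mathsf{Ft}$ is defined. *)

theory Defs
  imports "HOL-Analysis.Analysis"
begin

text \<open>The index set \<open>{1, \<dots>, m}\<close> is an arbitrary finite linearly ordered type, with
  \<open>m = CARD('m)\<close>. An element \<open>a\<close> of the algebra is its coefficient family, \<open>a $ A\<close> being the
  coefficient of \<open>e_A\<close>; then \<open>norm\<close> is the norm of the Clifford algebra. The instances of
  \<open>(*)\<close> and \<open>1\<close> on vectors are componentwise and are NOT the Clifford product and unit.\<close>

type_synonym 'm clifford = "real ^ 'm set"

definition e_blade :: "'m::{finite,linorder} set \<Rightarrow> 'm clifford" where
  "e_blade A = axis A 1"

abbreviation e_gen :: "'m::{finite,linorder} \<Rightarrow> 'm clifford" where
  "e_gen j \<equiv> e_blade {j}"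

abbreviation cl_one :: "'m::{finite,linorder} clifford" where
  "cl_one \<equiv> e_blade {}"

text \<open>Reordering \<open>e_A e_B\<close> costs one sign for each \<open>(i, j)\<close> in \<open>A \<times> B\<close> with \<open>j < i\<close>
  (anticommutation) and one for each \<open>i = j\<close> (from \<open>e_i\<^sup>2 = - 1\<close>).\<close>

definition blade_sign :: "'m::{finite,linorder} set \<Rightarrow> 'm set \<Rightarrow> real" where
  "blade_sign A B = (- 1) ^ card {(i, j). i \<in> A \<and> j \<in> B \<and> j \<le> i}"

definition cl_mult :: "'m::{finite,linorder} clifford \<Rightarrow> 'm clifford \<Rightarrow> 'm clifford"
    (infixl "\<odot>" 70) where
  "a \<odot> b = (\<Sum>A\<in>UNIV. \<Sum>B\<in>UNIV. (a $ A * b $ B * blade_sign A B) *\<^sub>R e_blade (sym_diff A B))"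

definition cl_cnj :: "'m::{finite,linorder} clifford \<Rightarrow> 'm clifford" where
  "cl_cnj a = (\<chi> A. (- 1) ^ (card A * (card A + 1) div 2) * a $ A)"

lemma bounded_bilinear_cl_mult: "bounded_bilinear cl_mult"
proof (rule bilinear_conv_bounded_bilinear[THEN iffD1])
  show "bilinear (cl_mult :: 'm::{finite,linorder} clifford \<Rightarrow> _)"
    unfolding bilinear_def cl_mult_def
    by (auto intro!: linearI
        simp: algebra_simps scaleR_add_left sum.distrib scaleR_sum_right)
qed

lemma e_blade_mult: "e_blade A \<odot> e_blade B = blade_sign A B *\<^sub>R e_blade (sym_diff A B)"
proof -
  have "e_blade A \<odot> e_blade B = (\<Sum>C\<in>UNIV. \<Sum>D\<in>UNIV. if C = A then if D = B
      then blade_sign A B *\<^sub>R e_blade (sym_diff A B) else 0 else 0)"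
    unfolding cl_mult_def by (intro sum.cong refl) (auto simp: e_blade_def axis_def)
  also have "\<dots> = blade_sign A B *\<^sub>R e_blade (sym_diff A B)"
    by (subst sum.swap) (simp add: sum.delta)
  finally show ?thesis .
qed

lemma blade_sign_prod:
  "blade_sign A B = (\<Prod>i\<in>A. \<Prod>j\<in>B. if j \<le> i then - 1 else 1)"
proof -
  have "(\<Prod>i\<in>A. \<Prod>j\<in>B. if j \<le> i then - 1 else 1) =
      (\<Prod>p\<in>A \<times> B. if snd p \<le> fst p then - 1 else (1::real))"
    by (simp add: prod.cartesian_product split_def)
  also have "\<dots> = (\<Prod>p\<in>{(i, j). i \<in> A \<and> j \<in> B \<and> j \<le> i}. - 1)"
    by (rule prod.mono_neutral_cong_right) auto
  finally show ?thesis by (simp add: blade_sign_def)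
qed

lemma e_gen_square: "e_gen j \<odot> e_gen j = - cl_one"
  by (simp add: e_blade_mult blade_sign_prod)

lemma e_gen_anticommute:
  assumes "j \<noteq> k"
  shows "e_gen j \<odot> e_gen k + e_gen k \<odot> e_gen j = 0"
proof -
  have "sym_diff {j} {k} = {j, k}" "sym_diff {k} {j} = {j, k}"
    using assms by auto
  then show ?thesis
    using assms by (cases j k rule: linorder_cases) (auto simp: e_blade_mult blade_sign_prod)
qed

lemma e_blade_insert_max:
  assumes "\<And>i. i \<in> A \<Longrightarrow> i < j"
  shows "e_blade (insert j A) = e_blade A \<odot> e_gen j"
proof -
  have "sym_diff A {j} = insert j A"
    using assms by force
  moreover have "blade_sign A {j} = 1"
    using assms by (auto simp: blade_sign_prod not_le intro!: prod.neutral)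
  ultimately show ?thesis by (simp add: e_blade_mult)
qed

lemma cl_expansion: "a = (\<Sum>A\<in>UNIV. a $ A *\<^sub>R e_blade A)"
  using basis_expansion[of a] by (simp add: e_blade_def scalar_mult_eq_scaleR)

lemma prod_sym_diff:
  fixes g :: "'a::finite \<Rightarrow> real"
  assumes "\<And>i. g i * g i = 1"
  shows "prod g (sym_diff A B) = prod g A * prod g B"
proof -
  have 1: "prod g (sym_diff A B) = prod g (A - B) * prod g (B - A)"
    by (rule prod.union_disjoint) auto
  have 2: "prod g A = prod g (A - B) * prod g (A \<inter> B)"
    by (subst prod.union_disjoint[symmetric]) (auto intro: prod.cong)
  have 3: "prod g B = prod g (B - A) * prod g (A \<inter> B)"
    by (subst prod.union_disjoint[symmetric]) (auto intro: prod.cong)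
  have 4: "prod g (A \<inter> B) * prod g (A \<inter> B) = 1"
    by (simp add: prod.distrib[symmetric] assms)
  show ?thesis unfolding 1 2 3 using 4 by (simp add: mult.assoc mult.left_commute)
qed

lemma blade_sign_sym_diff_left:
  "blade_sign (sym_diff A B) C = blade_sign A C * blade_sign B C"
  unfolding blade_sign_prod
  by (rule prod_sym_diff) (auto simp: prod.distrib[symmetric] intro!: prod.neutral)

lemma blade_sign_sym_diff_right:
  "blade_sign A (sym_diff B C) = blade_sign A B * blade_sign A C"
  unfolding blade_sign_prod
  by (simp add: prod_sym_diff prod.distrib)

lemma cl_mult_assoc: "(a \<odot> b) \<odot> c = a \<odot> (b \<odot> c)"
proof -
  interpret bounded_bilinear "cl_mult :: 'a clifford \<Rightarrow> _"
    by (rule bounded_bilinear_cl_mult)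
  have sd: "sym_diff (sym_diff A B) C = sym_diff A (sym_diff B C)" for A B C :: "'a set"
    by auto
  have *: "(e_blade A \<odot> e_blade B) \<odot> e_blade C = e_blade A \<odot> (e_blade B \<odot> e_blade C)"
    for A B C :: "'a set"
    by (simp add: e_blade_mult scaleR_left scaleR_right blade_sign_sym_diff_left
        blade_sign_sym_diff_right sd del: Un_Diff_cancel Un_Diff_cancel2 mult_minus1)
  have 1: "(a \<odot> e_blade B) \<odot> e_blade C = a \<odot> (e_blade B \<odot> e_blade C)" for B C
    by (subst (1 2) cl_expansion[of a]) (simp add: sum_left scaleR_left *)
  have 2: "(a \<odot> b) \<odot> e_blade C = a \<odot> (b \<odot> e_blade C)" for C
    by (subst (1 2) cl_expansion[of b]) (simp add: sum_left sum_right scaleR_left scaleR_right 1)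
  show ?thesis
    by (subst (1 2) cl_expansion[of c]) (simp add: sum_right scaleR_right 2)
qed

lemma cl_one_left: "cl_one \<odot> a = a"
  and cl_one_right: "a \<odot> cl_one = a"
proof -
  interpret bounded_bilinear "cl_mult :: 'a clifford \<Rightarrow> _"
    by (rule bounded_bilinear_cl_mult)
  show "cl_one \<odot> a = a"
    by (subst (1 2) cl_expansion[of a])
      (simp add: sum_right scaleR_right e_blade_mult blade_sign_def)
  show "a \<odot> cl_one = a"
    by (subst (1 2) cl_expansion[of a])
      (simp add: sum_left scaleR_left e_blade_mult blade_sign_def)
qed

text \<open>A point of \<open>\<real>\<^sup>m\<^sup>+\<^sup>1\<close> is a pair \<open>(x0, xv)\<close>; the library norm on pairs is Euclidean, and
  \<open>Basis\<close> is the standard basis.\<close>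

type_synonym 'm point = "real \<times> (real, 'm) vec"

definition cl_vector :: "(real, 'm) vec \<Rightarrow> 'm::{finite,linorder} clifford" where
  "cl_vector v = (\<Sum>j\<in>UNIV. v $ j *\<^sub>R e_gen j)"

definition paravector :: "'m point \<Rightarrow> 'm::{finite,linorder} clifford" where
  "paravector x = fst x *\<^sub>R cl_one + cl_vector (snd x)"

lemma cl_cnj_paravector: "cl_cnj (paravector x) = fst x *\<^sub>R cl_one - cl_vector (snd x)"
proof (rule vec_eq_iff[THEN iffD2], rule allI)
  fix A
  have "cl_vector (snd x) $ A = 0" if "card A \<noteq> 1"
    using that by (auto simp: cl_vector_def e_blade_def axis_def intro!: sum.neutral)
  moreover have "(cl_one :: 'a clifford) $ A = 0" if "card A = 1"
    using that by (auto simp: e_blade_def axis_def)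
  ultimately show "cl_cnj (paravector x) $ A = (fst x *\<^sub>R cl_one - cl_vector (snd x)) $ A"
    by (cases "card A = 1"; cases "A = {}")
      (auto simp: cl_cnj_def paravector_def e_blade_def axis_def)
qed

lemma norm_paravector: "norm (paravector x) = norm x"
proof -
  have i: "e_blade A \<bullet> e_blade B = (if A = B then 1 else 0)" for A B :: "'a set"
    by (simp add: e_blade_def inner_axis_axis)
  have "cl_vector v \<bullet> cl_vector v = v \<bullet> v" for v :: "(real, 'a) vec"
  proof -
    have "cl_vector v \<bullet> cl_vector v = (\<Sum>j\<in>UNIV. v $ j * v $ j)"
      by (simp add: cl_vector_def inner_sum_left inner_sum_right i if_distrib sum.delta cong: if_cong)
    then show ?thesis by (simp add: inner_vec_def)
  qed
  moreover have "cl_one \<bullet> cl_vector v = 0" "cl_vector v \<bullet> cl_one = 0" for v :: "(real, 'a) vec"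
    by (simp_all add: cl_vector_def inner_sum_left inner_sum_right i)
  ultimately show ?thesis
    by (simp add: norm_eq_sqrt_inner paravector_def inner_add_left inner_add_right i inner_prod_def)
qed

definition dir_deriv ::
    "'a::real_normed_vector \<Rightarrow> ('a \<Rightarrow> 'b::real_normed_vector) \<Rightarrow> 'a \<Rightarrow> 'b" where
  "dir_deriv v f x = vector_derivative (\<lambda>t. f (x + t *\<^sub>R v)) (at 0)"

definition laplacian ::
    "('a::euclidean_space \<Rightarrow> 'b::real_normed_vector) \<Rightarrow> 'a \<Rightarrow> 'b" where
  "laplacian f x = (\<Sum>b\<in>Basis. dir_deriv b (dir_deriv b f) x)"

definition CR_left ::
    "('m point \<Rightarrow> 'm clifford) \<Rightarrow> 'm point \<Rightarrow> 'm::{finite,linorder} clifford" where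
  "CR_left f x = dir_deriv (1, 0) f x + (\<Sum>j\<in>UNIV. e_gen j \<odot> dir_deriv (0, axis j 1) f x)"

definition CR_right ::
    "('m point \<Rightarrow> 'm clifford) \<Rightarrow> 'm point \<Rightarrow> 'm::{finite,linorder} clifford" where
  "CR_right f x = dir_deriv (1, 0) f x + (\<Sum>j\<in>UNIV. dir_deriv (0, axis j 1) f x \<odot> e_gen j)"

definition C1_on ::
    "'a::real_normed_vector set \<Rightarrow> ('a \<Rightarrow> 'b::real_normed_vector) \<Rightarrow> bool" where
  "C1_on S f \<longleftrightarrow> (\<exists>f' :: 'a \<Rightarrow> 'a \<Rightarrow>\<^sub>L 'b.
     (\<forall>x\<in>S. (f has_derivative blinfun_apply (f' x)) (at x)) \<and> continuous_on S f')"

definition left_monogenic_on ::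
    "'m point set \<Rightarrow> ('m point \<Rightarrow> 'm::{finite,linorder} clifford) \<Rightarrow> bool" where
  "left_monogenic_on S f \<longleftrightarrow> open S \<and> C1_on S f \<and> (\<forall>x\<in>S. CR_left f x = 0)"

definition right_monogenic_on ::
    "'m point set \<Rightarrow> ('m point \<Rightarrow> 'm::{finite,linorder} clifford) \<Rightarrow> bool" where
  "right_monogenic_on S f \<longleftrightarrow> open S \<and> C1_on S f \<and> (\<forall>x\<in>S. CR_right f x = 0)"

definition two_sided_monogenic_on ::
    "'m point set \<Rightarrow> ('m point \<Rightarrow> 'm::{finite,linorder} clifford) \<Rightarrow> bool" where
  "two_sided_monogenic_on S f \<longleftrightarrow> left_monogenic_on S f \<and> right_monogenic_on S f"

definition axial_extension ::
    "(complex \<Rightarrow> complex) \<Rightarrow> 'm point \<Rightarrow> 'm::{finite,linorder} clifford" where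
  "axial_extension f x =
     (let w = f (Complex (fst x) (norm (snd x)))
      in Re w *\<^sub>R cl_one + Im w *\<^sub>R cl_vector ((1 / norm (snd x)) *\<^sub>R snd x))"

text \<open>\<open>Ft f\<close> is \<open>Ft[f(z), 1]\<close>. It is meaningful for odd \<open>m\<close>, \<open>f\<close> holomorphic on the open upper
  half-plane and \<open>snd x \<noteq> 0\<close>; elsewhere its value is unspecified.\<close>

definition Ft ::
    "(complex \<Rightarrow> complex) \<Rightarrow> 'm point \<Rightarrow> 'm::{finite,linorder} clifford" where
  "Ft f = (laplacian ^^ ((CARD('m) - 1) div 2)) (axial_extension f)"

end

theory Submission imports Defs begin

text \<open>The function \<open>x \<mapsto> u(x0, r) + \<omega> v(x0, r)\<close> attached to a holomorphic \<open>u + i v\<close> is studied through the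
  two sequences \<open>U n = D^n u\<close> and \<open>V n = D^n (v/r)\<close>, where \<open>D = (1/r) d/dr\<close>, regarded as functions of
  \<open>x0\<close> and \<open>s = r\<^sup>2\<close>. The Cauchy-Riemann equations express all their first derivatives through the
  sequences themselves; a pair of sequences with these derivatives is called a Fueter chain. Write
  \<open>A n\<close> for \<open>U n + (V n)\<close> times the vector variable. For every chain the Laplacian maps \<open>A n\<close> to
  \<open>(m - 1 - 2 n) A (n + 1)\<close> (\<open>laplacian_fueter_chain\<close>), so for odd \<open>m\<close> the Fueter image is a nonzero
  multiple of \<open>A ((m - 1) / 2)\<close>. At just this level the chain relations are the equations of
  two-sided monogenicity (\<open>fueter_chain_two_sided_monogenic\<close>).

  Chains depend linearly on the holomorphic function, so \<open>exp (z\<^sup>2/2) / z\<close> may be split into \<open>1/z\<close> and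
  an entire function. For \<open>1/z\<close> the chain is explicit, and its level \<open>(m - 1) / 2\<close> is a multiple of the
  Cauchy kernel (\<open>axial_inverse\<close>). For the powers of \<open>z\<close> it consists of polynomials in \<open>x0\<close> and \<open>s\<close>,
  given by a recursion that also bounds them geometrically (\<open>power_fueter_chain\<close>,
  \<open>power_re_im_bound\<close>). The Taylor series of the entire part can therefore be summed at all levels
  (\<open>fueter_chain_suminf\<close>), and the sum is a chain for all real \<open>s\<close>, including \<open>s \<le> 0\<close>. As \<open>s\<close> is a
  polynomial in the coordinates, the axial function that it defines is monogenic across the real
  axis; this is the entire function \<open>M\<close>, up to a constant.

  For the decay, \<open>D\<close> multiplies \<open>exp (z\<^sup>2/2) / z\<close> by an element of an algebra of functions that
  are bounded for \<open>\<bar>x0\<bar> \<le> K\<close>, \<open>r \<ge> R\<close> and that \<open>D\<close> preserves (\<open>bounded_coeff\<close>). So every \<open>U n\<close> and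
  \<open>r (V n)\<close> is bounded by a constant multiple of \<open>\<bar>exp (z\<^sup>2/2) / z\<bar>\<close>, without any polynomial loss
  (\<open>gauss_chain_bound\<close>).\<close>

section \<open>Directional derivatives and the Laplacian\<close>

lemma dir_deriv_eq_derivative:
  assumes "(f has_derivative f') (at x)"
  shows "dir_deriv v f x = f' v"
proof -
  interpret f': bounded_linear f'
    using assms by (rule has_derivative_bounded_linear)
  have 1: "((\<lambda>t. x + t *\<^sub>R v) has_derivative (\<lambda>t. t *\<^sub>R v)) (at (0::real))"
    by (auto intro!: derivative_eq_intros)
  have "((f \<circ> (\<lambda>t. x + t *\<^sub>R v)) has_derivative (f' \<circ> (\<lambda>t. t *\<^sub>R v))) (at (0::real))"
    by (rule diff_chain_at[OF 1]) (use assms in simp)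
  then have "((\<lambda>t. f (x + t *\<^sub>R v)) has_vector_derivative f' v) (at 0)"
    by (simp add: has_vector_derivative_def comp_def f'.scaleR)
  then show ?thesis
    unfolding dir_deriv_def by (rule vector_derivative_at)
qed

text \<open>Iterating the Laplacian off the real axis replaces the function by a formula that is valid
  only on an open set; this makes the replacement harmless.\<close>

lemma dir_deriv_cong_open:
  assumes "open T" "x \<in> T" "\<And>y. y \<in> T \<Longrightarrow> f y = g y"
  shows "dir_deriv v f x = dir_deriv v g x"
proof -
  have "isCont (\<lambda>t::real. x + t *\<^sub>R v) 0"
    by (intro continuous_intros)
  then have "((\<lambda>t::real. x + t *\<^sub>R v) \<longlongrightarrow> x) (at 0)"
    by (simp add: isCont_def)
  then have "\<forall>\<^sub>F t::real in at 0. x + t *\<^sub>R v \<in> T"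
    using assms(1,2) by (rule topological_tendstoD)
  then have "\<forall>\<^sub>F t::real in nhds 0. t \<noteq> 0 \<longrightarrow> x + t *\<^sub>R v \<in> T"
    by (simp add: eventually_at_filter)
  then have "\<forall>\<^sub>F t::real in nhds 0. x + t *\<^sub>R v \<in> T"
    by (rule eventually_mono) (use assms(2) in \<open>metis add.right_neutral scaleR_zero_left\<close>)
  then have "\<forall>\<^sub>F t::real in nhds 0. f (x + t *\<^sub>R v) = g (x + t *\<^sub>R v)"
    by (rule eventually_mono) (rule assms(3))
  then show ?thesis
    unfolding dir_deriv_def by (intro vector_derivative_cong_eq) auto
qed

lemma laplacian_cong_open:
  assumes "open T" "x \<in> T" "\<And>y. y \<in> T \<Longrightarrow> f y = g y"
  shows "laplacian f x = laplacian g x"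
  unfolding laplacian_def
proof (rule sum.cong[OF refl])
  fix b
  show "dir_deriv b (dir_deriv b f) x = dir_deriv b (dir_deriv b g) x"
    by (rule dir_deriv_cong_open[OF assms(1,2)])
      (rule dir_deriv_cong_open[OF assms(1) _ assms(3)])
qed

lemma laplacian_point:
  fixes f :: "'m::finite point \<Rightarrow> 'b::real_normed_vector"
  shows "laplacian f x = dir_deriv (1, 0) (dir_deriv (1, 0) f) x
    + (\<Sum>j\<in>UNIV. dir_deriv (0, axis j 1) (dir_deriv (0, axis j 1) f) x)"
proof -
  have B: "(Basis :: 'm point set) = insert (1, 0) ((\<lambda>j. (0, axis j 1)) ` UNIV)"
    by (auto simp: Basis_prod_def Basis_vec_def)
  have inj: "inj (\<lambda>j::'m. (0::real, axis j (1::real)))"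
    by (auto simp: inj_on_def axis_eq_axis)
  show ?thesis
    unfolding laplacian_def B by (subst sum.insert) (auto simp: sum.reindex[OF inj])
qed

section \<open>Vectors in the Clifford algebra\<close>

lemma cl_vector_linear: "linear (cl_vector :: _ \<Rightarrow> 'm::{finite,linorder} clifford)"
  by (rule linearI)
    (simp_all add: cl_vector_def sum.distrib scaleR_add_left scaleR_sum_right)

lemma bounded_linear_cl_vector:
  "bounded_linear (cl_vector :: _ \<Rightarrow> 'm::{finite,linorder} clifford)"
  using cl_vector_linear by (rule linear_conv_bounded_linear[THEN iffD1])

lemma cl_vector_axis: "cl_vector (axis j 1) = e_gen j"
proof -
  have "cl_vector (axis j 1) = (\<Sum>k\<in>UNIV. if k = j then e_gen k else 0)"
    unfolding cl_vector_def by (rule sum.cong) (auto simp: axis_def)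
  then show ?thesis by simp
qed

lemma cl_vector_zero: "cl_vector 0 = 0"
  using cl_vector_linear by (rule linear_0)

lemma norm_cl_vector: "norm (cl_vector v) = norm v"
  using norm_paravector[of "(0, v)"] by (simp add: paravector_def norm_Pair)

lemma norm_cl_one: "norm (cl_one :: 'm::{finite,linorder} clifford) = 1"
  using norm_paravector[of "(1, 0) :: 'm point"]
  by (simp add: paravector_def cl_vector_zero norm_Pair)

text \<open>The mixed terms cancel in pairs, because the symmetrized double sum contains only the
  anticommutators of the generators.\<close>

lemma cl_vector_square: "cl_vector v \<odot> cl_vector v = - ((norm v)\<^sup>2 *\<^sub>R cl_one)"
proof -
  interpret bounded_bilinear "cl_mult :: 'a clifford \<Rightarrow> _"
    by (rule bounded_bilinear_cl_mult)
  let ?t = "\<lambda>i j. (v $ i * v $ j) *\<^sub>R (e_gen i \<odot> e_gen j)"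
  have 1: "cl_vector v \<odot> cl_vector v = (\<Sum>i\<in>UNIV. \<Sum>j\<in>UNIV. ?t i j)"
    by (simp add: cl_vector_def sum_left sum_right scaleR_left scaleR_right scaleR_sum_right
        mult.commute) (subst sum.swap, simp add: mult.commute)
  have "2 *\<^sub>R (cl_vector v \<odot> cl_vector v) = (\<Sum>i\<in>UNIV. \<Sum>j\<in>UNIV. ?t i j + ?t j i)"
    unfolding sum.distrib by (subst (2) sum.swap) (simp add: 1 scaleR_2)
  also have "\<dots> = (\<Sum>i\<in>UNIV. \<Sum>j\<in>UNIV. if j = i then - (2 * (v $ i)\<^sup>2) *\<^sub>R cl_one else 0)"
  proof (intro sum.cong refl)
    fix i j
    show "?t i j + ?t j i = (if j = i then - (2 * (v $ i)\<^sup>2) *\<^sub>R cl_one else 0)"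
    proof (cases "j = i")
      case True
      then show ?thesis
        by (simp add: e_gen_square power2_eq_square flip: scaleR_2)
    next
      case False
      have "?t i j + ?t j i = (v $ i * v $ j) *\<^sub>R (e_gen i \<odot> e_gen j + e_gen j \<odot> e_gen i)"
        by (simp add: scaleR_add_right mult.commute)
      then show ?thesis using False by (simp add: e_gen_anticommute)
    qed
  qed
  also have "\<dots> = (\<Sum>i\<in>UNIV. - (2 * (v $ i)\<^sup>2) *\<^sub>R cl_one)"
    by simp
  also have "\<dots> = (- 2 * (\<Sum>i\<in>UNIV. (v $ i)\<^sup>2)) *\<^sub>R cl_one"
    unfolding sum_distrib_left scaleR_sum_left by simp
  also have "\<dots> = 2 *\<^sub>R (- ((norm v)\<^sup>2 *\<^sub>R cl_one))"
    by (simp add: norm_vec_def L2_set_def sum_nonneg)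
  finally show ?thesis by (simp only: scaleR_cancel_left) simp
qed

section \<open>Axial functions\<close>

text \<open>The second variable of the profiles \<open>p\<close> and \<open>q\<close> is \<open>r\<^sup>2\<close>, not \<open>r\<close>: the square is smooth on the
  whole space, so that smooth profiles give a function that is smooth across the real axis. The
  factor \<open>cl_vector (snd x)\<close> is \<open>r\<close> times the unit vector \<open>\<omega>\<close>, so \<open>q\<close> stands for \<open>v / r\<close>.\<close>

definition axial :: "(real \<times> real \<Rightarrow> real) \<Rightarrow> (real \<times> real \<Rightarrow> real) \<Rightarrow> 'm point
    \<Rightarrow> 'm::{finite,linorder} clifford" where
  "axial p q x = p (fst x, (norm (snd x))\<^sup>2) *\<^sub>R cl_one
     + q (fst x, (norm (snd x))\<^sup>2) *\<^sub>R cl_vector (snd x)"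

lemma axial_scale: "axial (\<lambda>w. c * p w) (\<lambda>w. c * q w) x = c *\<^sub>R axial p q x"
  by (simp add: axial_def scaleR_add_right)

lemma axial_add:
  "axial (\<lambda>w. p w + p' w) (\<lambda>w. q w + q' w) x = axial p q x + axial p' q' x"
  by (simp add: axial_def scaleR_add_left)

abbreviation polar :: "'m::finite point \<Rightarrow> real \<times> real" where
  "polar x \<equiv> (fst x, (norm (snd x))\<^sup>2)"

lemma polar_has_derivative:
  "(polar has_derivative (\<lambda>h. (fst h, 2 * (snd x \<bullet> snd h)))) (at x)"
  unfolding power2_norm_eq_inner
  by (auto intro!: derivative_eq_intros simp: inner_commute)

lemma compose_polar_has_derivative:
  assumes "(p has_derivative p') (at (polar x))"
  shows "((\<lambda>y. p (polar y)) has_derivative (\<lambda>h. p' (fst h, 2 * (snd x \<bullet> snd h)))) (at x)"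
  using diff_chain_at[OF polar_has_derivative assms] by (simp add: comp_def)

lemma axial_has_derivative:
  assumes "(p has_derivative p') (at (polar x))" and "(q has_derivative q') (at (polar x))"
  shows "(axial p q has_derivative (\<lambda>h. p' (fst h, 2 * (snd x \<bullet> snd h)) *\<^sub>R cl_one
      + q' (fst h, 2 * (snd x \<bullet> snd h)) *\<^sub>R cl_vector (snd x)
      + q (polar x) *\<^sub>R cl_vector (snd h))) (at x)"
proof -
  note [derivative_intros] = bounded_linear.has_derivative[OF bounded_linear_cl_vector]
  show ?thesis
    unfolding axial_def[abs_def]
    by (rule derivative_eq_intros compose_polar_has_derivative[OF assms(1)]
        compose_polar_has_derivative[OF assms(2)] refl)+ (simp add: fun_eq_iff)
qed

section \<open>Fueter chains\<close>

text \<open>If \<open>u + i v\<close> is holomorphic and \<open>D = (1/r) d/dr\<close>, then \<open>U n = D^n u\<close> and \<open>V n = D^n (v/r)\<close>, as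
  functions of \<open>(x0, s)\<close> with \<open>s = r\<^sup>2\<close>, form a chain. Since \<open>D = 2 d/ds\<close>, the derivatives in \<open>s\<close>
  merely raise the index. Those in \<open>x0\<close> are the Cauchy-Riemann equations: \<open>d/dx0 (v/r) = - D u\<close>
  commutes with \<open>D\<close>, and \<open>d/dx0 u = dv/dr = V 0 + s (V 1)\<close> gains \<open>2\<close> in the
  coefficient of its first term whenever \<open>D\<close> is applied, by the product rule for \<open>s\<close>. Since all first derivatives are again members of
  the chain, its members are smooth and every second derivative can be read off.\<close>

definition fueter_chain ::
    "(real \<times> real) set \<Rightarrow> (nat \<Rightarrow> real \<times> real \<Rightarrow> real) \<Rightarrow> (nat \<Rightarrow> real \<times> real \<Rightarrow> real) \<Rightarrow> bool" where
  "fueter_chain S U V \<longleftrightarrow> (\<forall>n. \<forall>w\<in>S.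
     (U n has_derivative (\<lambda>h. fst h * ((2 * real n + 1) * V n w + snd w * V (Suc n) w)
        + snd h * (U (Suc n) w / 2))) (at w) \<and>
     (V n has_derivative (\<lambda>h. - fst h * U (Suc n) w + snd h * (V (Suc n) w / 2))) (at w))"

lemma fueter_chainD:
  assumes "fueter_chain S U V" "w \<in> S"
  shows "(U n has_derivative (\<lambda>h. fst h * ((2 * real n + 1) * V n w + snd w * V (Suc n) w)
        + snd h * (U (Suc n) w / 2))) (at w)"
    and "(V n has_derivative (\<lambda>h. - fst h * U (Suc n) w + snd h * (V (Suc n) w / 2))) (at w)"
  using assms by (simp_all add: fueter_chain_def)

text \<open>The partial derivative in \<open>x0\<close> is again axial, and the gradient in the vector variable has a
  radial part, which raises the index, and a part coming from the factor \<open>cl_vector (snd x)\<close>.\<close>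

lemma fueter_chain_axial_derivative:
  assumes "fueter_chain S U V" "polar x \<in> S"
  shows "(axial (U n) (V n) has_derivative (\<lambda>h.
     fst h *\<^sub>R axial (\<lambda>w. (2 * real n + 1) * V n w + snd w * V (Suc n) w) (\<lambda>w. - U (Suc n) w) x
     + (snd x \<bullet> snd h) *\<^sub>R axial (U (Suc n)) (V (Suc n)) x
     + V n (polar x) *\<^sub>R cl_vector (snd h))) (at x)"
  by (rule has_derivative_eq_rhs[OF axial_has_derivative[OF fueter_chainD[OF assms]]])
    (simp add: axial_def fun_eq_iff algebra_simps scaleR_add_left)

lemma fueter_chain_dir_deriv:
  assumes "fueter_chain S U V" "polar x \<in> S"
  shows "dir_deriv (1, 0) (axial (U n) (V n)) x
      = axial (\<lambda>w. (2 * real n + 1) * V n w + snd w * V (Suc n) w) (\<lambda>w. - U (Suc n) w) x"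
    and "dir_deriv (0, axis j 1) (axial (U n) (V n)) x
      = snd x $ j *\<^sub>R axial (U (Suc n)) (V (Suc n)) x + V n (polar x) *\<^sub>R e_gen j"
  by (simp_all add: dir_deriv_eq_derivative[OF fueter_chain_axial_derivative[OF assms]]
      cl_vector_axis cl_vector_zero inner_axis)

lemma open_polar_vimage:
  assumes "open S"
  shows "open {x :: 'm::finite point. polar x \<in> S}"
proof -
  have "continuous_on UNIV (polar :: 'm point \<Rightarrow> _)"
    by (intro continuous_intros)
  then show ?thesis
    using assms by (simp add: continuous_on_open_vimage vimage_def)
qed

lemma sum_coordinate_e_gen: "(\<Sum>j\<in>UNIV. v $ j *\<^sub>R e_gen j) = cl_vector v"
  by (simp add: cl_vector_def)

lemma sum_coordinate_square: "(\<Sum>j\<in>UNIV. (v $ j)\<^sup>2) = (norm (v :: real ^ 'm::finite))\<^sup>2"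
  by (simp add: norm_vec_def L2_set_def sum_nonneg)

text \<open>The Laplacian only raises the index because the terms with index \<open>n + 2\<close> cancel: the
  Cauchy-Riemann equations, applied twice in \<open>x0\<close>, give \<open>- s\<close> times them and the radial second
  derivatives give \<open>+ s\<close> times them. Of the terms with index \<open>n + 1\<close>, those from \<open>x0\<close> contribute
  \<open>- (2 n + 1)\<close> to the factor and those from the other variables \<open>m\<close> (for the vector part
  \<open>- (2 n + 3)\<close> and \<open>m + 2\<close>).\<close>

lemma laplacian_fueter_chain:
  assumes chain: "fueter_chain S U V" and "open S" and x: "polar x \<in> S"
  shows "laplacian (axial (U n) (V n)) x
    = (real CARD('m) - 1 - 2 * real n) *\<^sub>R
        (axial (U (Suc n)) (V (Suc n)) x :: 'm::{finite,linorder} clifford)"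
proof -
  define T where "T = {x :: 'm point. polar x \<in> S}"
  have T: "open T" "x \<in> T"
    using assms open_polar_vimage by (auto simp: T_def)
  let ?A = "\<lambda>k. axial (U k) (V k) :: 'm point \<Rightarrow> 'm clifford"
  let ?N = "Suc n"
  have D0: "dir_deriv (1, 0) (dir_deriv (1, 0) (?A n)) x
      = axial (\<lambda>w. - ((2 * real n + 1) * U ?N w) - snd w * U (Suc ?N) w)
          (\<lambda>w. - ((2 * real ?N + 1) * V ?N w + snd w * V (Suc ?N) w)) x"
  proof -
    have P: "((\<lambda>w. (2 * real n + 1) * V n w + snd w * V ?N w) has_derivative
       (\<lambda>h. (2 * real n + 1) * (- fst h * U ?N (polar x) + snd h * (V ?N (polar x) / 2))
         + (snd (polar x) * (- fst h * U (Suc ?N) (polar x) + snd h * (V (Suc ?N) (polar x) / 2))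
         + snd h * V ?N (polar x)))) (at (polar x))"
      by (intro has_derivative_add has_derivative_mult has_derivative_mult_right
          has_derivative_snd has_derivative_ident fueter_chainD[OF chain x])
    have Q: "((\<lambda>w. - U ?N w) has_derivative (\<lambda>h. - (fst h * ((2 * real ?N + 1) * V ?N (polar x)
        + snd (polar x) * V (Suc ?N) (polar x)) + snd h * (U (Suc ?N) (polar x) / 2)))) (at (polar x))"
      by (intro has_derivative_minus fueter_chainD[OF chain x])
    have "dir_deriv (1, 0) (dir_deriv (1, 0) (?A n)) x = dir_deriv (1, 0)
        (axial (\<lambda>w. (2 * real n + 1) * V n w + snd w * V ?N w) (\<lambda>w. - U ?N w)) x"
      by (rule dir_deriv_cong_open[OF T])
        (simp add: T_def fueter_chain_dir_deriv[OF chain])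
    then show ?thesis
      by (simp add: dir_deriv_eq_derivative[OF axial_has_derivative[OF P Q]] cl_vector_zero)
        (simp add: axial_def)
  qed
  have Dj: "dir_deriv (0, axis j 1) (dir_deriv (0, axis j 1) (?A n)) x
      = ?A ?N x + (snd x $ j)\<^sup>2 *\<^sub>R ?A (Suc ?N) x
        + (2 * V ?N (polar x)) *\<^sub>R (snd x $ j *\<^sub>R e_gen j)" for j
  proof -
    have P: "((\<lambda>y. snd y $ j *\<^sub>R ?A ?N y + V n (polar y) *\<^sub>R e_gen j) has_derivative
       (\<lambda>h. (snd x $ j *\<^sub>R (fst h *\<^sub>R axial (\<lambda>w. (2 * real ?N + 1) * V ?N w + snd w * V (Suc ?N) w)
              (\<lambda>w. - U (Suc ?N) w) x
           + (snd x \<bullet> snd h) *\<^sub>R ?A (Suc ?N) x + V ?N (polar x) *\<^sub>R cl_vector (snd h))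
           + (snd h $ j) *\<^sub>R ?A ?N x)
         + (- fst (fst h, 2 * (snd x \<bullet> snd h)) * U ?N (polar x)
           + snd (fst h, 2 * (snd x \<bullet> snd h)) * (V ?N (polar x) / 2)) *\<^sub>R e_gen j)) (at x)"
      by (intro has_derivative_add has_derivative_scaleR has_derivative_scaleR_left
          fueter_chain_axial_derivative[OF chain x]
          compose_polar_has_derivative fueter_chainD(2)[OF chain x]
          bounded_linear.has_derivative[OF bounded_linear_vec_nth]
          has_derivative_snd has_derivative_ident)
    have "dir_deriv (0, axis j 1) (dir_deriv (0, axis j 1) (?A n)) x
      = dir_deriv (0, axis j 1) (\<lambda>y. snd y $ j *\<^sub>R ?A ?N y + V n (polar y) *\<^sub>R e_gen j) x"
      by (rule dir_deriv_cong_open[OF T])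
        (simp add: T_def fueter_chain_dir_deriv[OF chain])
    also have "\<dots> = ?A ?N x + (snd x $ j)\<^sup>2 *\<^sub>R ?A (Suc ?N) x
        + (2 * V ?N (polar x)) *\<^sub>R (snd x $ j *\<^sub>R e_gen j)"
      unfolding dir_deriv_eq_derivative[OF P]
      by (simp add: cl_vector_axis inner_axis algebra_simps power2_eq_square flip: scaleR_2)
    finally show ?thesis .
  qed
  have "laplacian (?A n) x = dir_deriv (1, 0) (dir_deriv (1, 0) (?A n)) x
      + (real CARD('m) *\<^sub>R ?A ?N x + (norm (snd x))\<^sup>2 *\<^sub>R ?A (Suc ?N) x
      + (2 * V ?N (polar x)) *\<^sub>R cl_vector (snd x))"
    unfolding laplacian_point Dj sum.distrib
      scaleR_sum_left[symmetric] scaleR_sum_right[symmetric]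
      sum_coordinate_square sum_coordinate_e_gen sum_constant_scaleR by simp
  then show ?thesis
    by (simp add: D0) (simp add: axial_def vec_eq_iff algebra_simps)
qed

lemma fueter_chain_subset:
  assumes "fueter_chain S U V" "T \<subseteq> S"
  shows "fueter_chain T U V"
  using assms by (auto simp: fueter_chain_def)

lemma fueter_chain_scale:
  assumes "fueter_chain S U V"
  shows "fueter_chain S (\<lambda>n w. c * U n w) (\<lambda>n w. c * V n w)"
  unfolding fueter_chain_def
proof (intro allI ballI conjI)
  fix n w assume w: "w \<in> S"
  show "((\<lambda>w. c * U n w) has_derivative (\<lambda>h. fst h * ((2 * real n + 1) * (c * V n w)
      + snd w * (c * V (Suc n) w)) + snd h * (c * U (Suc n) w / 2))) (at w)"
    by (rule has_derivative_eq_rhs[OF has_derivative_mult_right[OF fueter_chainD(1)[OF assms w]]])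
      (simp add: fun_eq_iff algebra_simps)
  show "((\<lambda>w. c * V n w) has_derivative
      (\<lambda>h. - fst h * (c * U (Suc n) w) + snd h * (c * V (Suc n) w / 2))) (at w)"
    by (rule has_derivative_eq_rhs[OF has_derivative_mult_right[OF fueter_chainD(2)[OF assms w]]])
      (simp add: fun_eq_iff algebra_simps)
qed

lemma fueter_chain_add:
  assumes "fueter_chain S U V" "fueter_chain S U' V'"
  shows "fueter_chain S (\<lambda>n w. U n w + U' n w) (\<lambda>n w. V n w + V' n w)"
  unfolding fueter_chain_def
proof (intro allI ballI conjI)
  fix n w assume w: "w \<in> S"
  show "((\<lambda>w. U n w + U' n w) has_derivative (\<lambda>h. fst h * ((2 * real n + 1) * (V n w + V' n w)
      + snd w * (V (Suc n) w + V' (Suc n) w)) + snd h * ((U (Suc n) w + U' (Suc n) w) / 2))) (at w)"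
    by (rule has_derivative_eq_rhs[OF has_derivative_add[OF fueter_chainD(1)[OF assms(1) w]
          fueter_chainD(1)[OF assms(2) w]]]) (simp add: fun_eq_iff field_simps)
  show "((\<lambda>w. V n w + V' n w) has_derivative (\<lambda>h. - fst h * (U (Suc n) w + U' (Suc n) w)
      + snd h * ((V (Suc n) w + V' (Suc n) w) / 2))) (at w)"
    by (rule has_derivative_eq_rhs[OF has_derivative_add[OF fueter_chainD(2)[OF assms(1) w]
          fueter_chainD(2)[OF assms(2) w]]]) (simp add: fun_eq_iff field_simps)
qed

text \<open>The partial results are scalar multiples of members of a chain, hence members of the
  multiplied chain, and \<open>laplacian_fueter_chain\<close> applies at every stage.\<close>

lemma laplacian_power_fueter_chain:
  assumes chain: "fueter_chain S U V" and "open S"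
    and f: "\<And>y. polar y \<in> S \<Longrightarrow> f y = (axial (U 0) (V 0) y :: 'm::{finite,linorder} clifford)"
    and x: "polar x \<in> S"
  shows "(laplacian ^^ k) f x
    = (\<Prod>i<k. real CARD('m) - 1 - 2 * real i) *\<^sub>R axial (U k) (V k) x"
  using x
proof (induction k arbitrary: x)
  case 0
  then show ?case by (simp add: f)
next
  case (Suc k)
  define c where "c = (\<Prod>i<k. real CARD('m) - 1 - 2 * real i)"
  have "(laplacian ^^ Suc k) f x = laplacian (axial (\<lambda>w. c * U k w) (\<lambda>w. c * V k w)) x"
    using Suc.prems unfolding funpow.simps comp_def
    by (intro laplacian_cong_open[OF open_polar_vimage[OF \<open>open S\<close>]]) (auto simp: Suc.IH axial_scale simp flip: c_def)
  also have "\<dots> = (\<Prod>i<Suc k. real CARD('m) - 1 - 2 * real i) *\<^sub>R axial (U (Suc k)) (V (Suc k)) x"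
    using laplacian_fueter_chain[OF fueter_chain_scale[OF chain] \<open>open S\<close> Suc.prems]
    by (simp add: c_def axial_scale)
  finally show ?case .
qed

lemma C1_on_fueter_chain:
  assumes chain: "fueter_chain UNIV U V"
  shows "C1_on UNIV (axial (U n) (V n))"
proof -
  define D where "D = (\<lambda>x h.
     fst h *\<^sub>R axial (\<lambda>w. (2 * real n + 1) * V n w + snd w * V (Suc n) w) (\<lambda>w. - U (Suc n) w) x
     + (snd x \<bullet> snd h) *\<^sub>R axial (U (Suc n)) (V (Suc n)) x
     + V n (polar x) *\<^sub>R cl_vector (snd h) :: 'a clifford)"
  have D: "(axial (U n) (V n) has_derivative D x) (at x)" for x
    unfolding D_def by (rule fueter_chain_axial_derivative[OF chain UNIV_I])
  have UV: "continuous_on UNIV (U k)" "continuous_on UNIV (V k)" for k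
    using fueter_chainD[OF chain UNIV_I]
    by (meson continuous_at_imp_continuous_on has_derivative_continuous)+
  have 1: "continuous_on UNIV (\<lambda>x. D x h)" for h
    unfolding D_def axial_def
    by (intro continuous_intros continuous_on_compose2[OF UV(1)] continuous_on_compose2[OF UV(2)]
        bounded_linear.continuous_on[OF bounded_linear_cl_vector]) auto
  have 2: "blinfun_apply (Blinfun (D x)) = D x" for x
    by (intro bounded_linear_Blinfun_apply has_derivative_bounded_linear[OF D])
  show ?thesis
    unfolding C1_on_def
  proof (intro exI conjI ballI)
    show "(axial (U n) (V n) has_derivative blinfun_apply (Blinfun (D x))) (at x)" for x
      unfolding 2 by (rule D)
    show "continuous_on UNIV (\<lambda>x. Blinfun (D x))"
      by (rule continuous_on_blinfun_componentwise) (simp add: 2 1)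
  qed
qed

text \<open>This is Fueter's theorem: the conditions for an axial function with profiles \<open>p\<close>, \<open>q\<close> to be
  annihilated by the Cauchy-Riemann operator are \<open>dp/dx0 = m q + 2 s dq/ds\<close> and
  \<open>dq/dx0 = - 2 dp/ds\<close>. The second holds at every level of the chain, the first one at the level
  \<open>2 n + 1 = m\<close>. Both sides behave alike because the only products that occur, \<open>e_j e_j\<close> and those of
  \<open>cl_vector (snd x)\<close> with axial values at the same point, commute.\<close>

lemma fueter_chain_two_sided_monogenic:
  assumes chain: "fueter_chain UNIV U V" and m: "CARD('m::{finite,linorder}) = 2 * n + 1"
  shows "two_sided_monogenic_on UNIV (axial (U n) (V n) :: 'm point \<Rightarrow> 'm clifford)"
proof -
  interpret bounded_bilinear "cl_mult :: 'm clifford \<Rightarrow> _"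
    by (rule bounded_bilinear_cl_mult)
  let ?A = "axial (U n) (V n) :: 'm point \<Rightarrow> 'm clifford"
  let ?B = "\<lambda>x :: 'm point. axial (U (Suc n)) (V (Suc n)) x :: 'm clifford"
  note d = fueter_chain_dir_deriv[OF chain UNIV_I]
  have n: "real CARD('m) = 2 * real n + 1"
    using m by simp
  have left: "CR_left ?A x = 0" for x
  proof -
    have "(\<Sum>j\<in>UNIV. e_gen j \<odot> dir_deriv (0, axis j 1) ?A x)
        = (\<Sum>j\<in>UNIV. snd x $ j *\<^sub>R e_gen j) \<odot> ?B x
          + V n (polar x) *\<^sub>R (\<Sum>j\<in>(UNIV::'m set). e_gen j \<odot> e_gen j)"
      by (simp add: d add_right scaleR_right scaleR_left sum_left sum.distrib scaleR_sum_right)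
    also have "\<dots> = cl_vector (snd x) \<odot> ?B x - (V n (polar x) * real CARD('m)) *\<^sub>R cl_one"
      unfolding sum_coordinate_e_gen e_gen_square sum_constant_scaleR by simp
    finally show ?thesis
      unfolding CR_left_def d(1) n
      by (simp add: axial_def add_right scaleR_right cl_one_right cl_vector_square)
        (simp add: vec_eq_iff algebra_simps)
  qed
  have right: "CR_right ?A x = 0" for x
  proof -
    have "(\<Sum>j\<in>UNIV. dir_deriv (0, axis j 1) ?A x \<odot> e_gen j)
        = ?B x \<odot> (\<Sum>j\<in>UNIV. snd x $ j *\<^sub>R e_gen j)
          + V n (polar x) *\<^sub>R (\<Sum>j\<in>(UNIV::'m set). e_gen j \<odot> e_gen j)"
      by (simp add: d add_left scaleR_right scaleR_left sum_right sum.distrib scaleR_sum_right)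
    also have "\<dots> = ?B x \<odot> cl_vector (snd x) - (V n (polar x) * real CARD('m)) *\<^sub>R cl_one"
      unfolding sum_coordinate_e_gen e_gen_square sum_constant_scaleR by simp
    finally show ?thesis
      unfolding CR_right_def d(1) n
      by (simp add: axial_def add_left scaleR_left cl_one_left cl_vector_square)
        (simp add: vec_eq_iff algebra_simps)
  qed
  show ?thesis
    using left right C1_on_fueter_chain[OF chain]
    by (simp add: two_sided_monogenic_on_def left_monogenic_on_def right_monogenic_on_def)
qed

section \<open>The chain of 1/z: the Cauchy kernel\<close>

text \<open>The profiles of \<open>1/z\<close> are \<open>x0 / (x0\<^sup>2 + s)\<close> and \<open>- 1 / (x0\<^sup>2 + s)\<close>, and applying \<open>2 d/ds\<close> to them \<open>n\<close>
  times gives these formulas. At the level \<open>n = (m - 1) / 2\<close> they are the Cauchy kernel up to a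
  constant (\<open>axial_inverse\<close> below).\<close>

definition inverse_re :: "nat \<Rightarrow> real \<times> real \<Rightarrow> real" where
  "inverse_re n w = (- 2) ^ n * fact n * fst w / ((fst w)\<^sup>2 + snd w) ^ Suc n"

definition inverse_im :: "nat \<Rightarrow> real \<times> real \<Rightarrow> real" where
  "inverse_im n w = - ((- 2) ^ n * fact n / ((fst w)\<^sup>2 + snd w) ^ Suc n)"

lemma inverse_fueter_chain:
  "fueter_chain {w. 0 < snd w} inverse_re inverse_im"
  unfolding fueter_chain_def inverse_re_def[abs_def] inverse_im_def[abs_def]
proof (intro allI ballI conjI)
  fix n and w :: "real \<times> real" assume "w \<in> {w. 0 < snd w}"
  then have pos: "(fst w)\<^sup>2 + snd w > 0"
    by (simp add: add_nonneg_pos)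
  define N where "N = (fst w)\<^sup>2 + snd w"
  define c :: real where "c = (- 2) ^ n * fact n"
  have c: "(- 2) ^ Suc n * fact (Suc n) = - 2 * (1 + real n) * c"
    by (simp add: c_def algebra_simps)
  have N: "N \<noteq> 0" using pos by (simp add: N_def)
  have "((\<lambda>t. inverse (t ^ Suc n)) has_field_derivative - (1 + real n) / N ^ Suc (Suc n)) (at N)"
    by (rule DERIV_cong[OF DERIV_inverse'[OF DERIV_pow]]) (use N in \<open>simp_all add: field_simps\<close>)
  moreover have "((\<lambda>w. (fst w)\<^sup>2 + snd w) has_derivative (\<lambda>h. 2 * fst w * fst h + snd h)) (at w)"
    by (rule derivative_eq_intros refl)+ (simp add: fun_eq_iff)
  ultimately have P: "((\<lambda>w. inverse (((fst w)\<^sup>2 + snd w) ^ Suc n)) has_derivative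
      (\<lambda>h. (2 * fst w * fst h + snd h) * (- (1 + real n) / N ^ Suc (Suc n)))) (at w)"
    unfolding N_def by (intro DERIV_compose_FDERIV)
  show "((\<lambda>w. (- 2) ^ n * fact n * fst w / ((fst w)\<^sup>2 + snd w) ^ Suc n) has_derivative
     (\<lambda>h. fst h * ((2 * real n + 1) * - ((- 2) ^ n * fact n / ((fst w)\<^sup>2 + snd w) ^ Suc n)
       + snd w * - ((- 2) ^ Suc n * fact (Suc n) / ((fst w)\<^sup>2 + snd w) ^ Suc (Suc n)))
       + snd h * ((- 2) ^ Suc n * fact (Suc n) * fst w / ((fst w)\<^sup>2 + snd w) ^ Suc (Suc n) / 2))) (at w)"
  proof -
    \<comment> \<open>Eliminating \<open>s\<close> in favour of \<open>N\<close> leaves a rational identity in \<open>N\<close> and \<open>x0\<close>.\<close>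
    have s: "snd w = N - fst w * fst w" by (simp add: N_def power2_eq_square)
    show ?thesis
      unfolding c c_def[symmetric] divide_inverse
      by (rule has_derivative_eq_rhs[OF has_derivative_mult[OF has_derivative_mult_right[OF
            has_derivative_fst[OF has_derivative_ident]] P]], unfold N_def[symmetric])
        (use N in \<open>simp add: fun_eq_iff s field_simps\<close>)
  qed
  show "((\<lambda>w. - ((- 2) ^ n * fact n / ((fst w)\<^sup>2 + snd w) ^ Suc n)) has_derivative
     (\<lambda>h. - fst h * ((- 2) ^ Suc n * fact (Suc n) * fst w / ((fst w)\<^sup>2 + snd w) ^ Suc (Suc n))
       + snd h * (- ((- 2) ^ Suc n * fact (Suc n) / ((fst w)\<^sup>2 + snd w) ^ Suc (Suc n)) / 2))) (at w)"
    unfolding c c_def[symmetric] divide_inverse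
    by (rule has_derivative_eq_rhs[OF has_derivative_minus[OF has_derivative_mult_right[OF P]]],
        unfold N_def[symmetric]) (use N in \<open>simp add: fun_eq_iff field_simps\<close>)
qed

lemma axial_inverse:
  fixes x :: "'m::{finite,linorder} point"
  assumes "CARD('m) = 2 * n + 1"
  shows "axial (inverse_re n) (inverse_im n) x
    = ((- 2) ^ n * fact n) *\<^sub>R ((1 / norm x ^ (CARD('m) + 1)) *\<^sub>R cl_cnj (paravector x))"
proof -
  have "(norm x)\<^sup>2 = (fst x)\<^sup>2 + (norm (snd x))\<^sup>2"
    by (cases x) (simp add: norm_Pair)
  moreover have "norm x ^ (CARD('m) + 1) = ((norm x)\<^sup>2) ^ Suc n"
    unfolding assms power_mult[symmetric] by simp
  ultimately show ?thesis
    by (simp add: axial_def inverse_re_def inverse_im_def cl_cnj_paravector scaleR_diff_right)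
qed

lemma inverse_Complex:
  "1 / Complex x y = Complex (inverse_re 0 (x, y\<^sup>2)) (y * inverse_im 0 (x, y\<^sup>2))"
  by (simp add: complex_eq_iff inverse_re_def inverse_im_def Re_divide Im_divide)

section \<open>The chains of the powers of z\<close>

text \<open>The recursion is \<open>D^n\<close> applied to \<open>u\<close> and \<open>v / y\<close> for \<open>u + i v = z \<cdot> z^k\<close>, where \<open>D = 2 d/ds\<close> with \<open>s = y\<^sup>2\<close>. The
  summand with index \<open>n - 1\<close> comes from the product rule for the factor \<open>s\<close> in \<open>s V\<close>; for \<open>n = 0\<close> the
  truncated subtraction does no harm, because the summand carries the factor \<open>n\<close>.\<close>

fun power_re :: "nat \<Rightarrow> nat \<Rightarrow> real \<times> real \<Rightarrow> real"
  and power_im :: "nat \<Rightarrow> nat \<Rightarrow> real \<times> real \<Rightarrow> real" where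
  "power_re 0 n w = (if n = 0 then 1 else 0)"
| "power_im 0 n w = 0"
| "power_re (Suc k) n w = fst w * power_re k n w - snd w * power_im k n w
     - 2 * real n * power_im k (n - 1) w"
| "power_im (Suc k) n w = fst w * power_im k n w + power_re k n w"

lemma power_re_im:
  "Complex x y ^ k = Complex (power_re k 0 (x, y\<^sup>2)) (y * power_im k 0 (x, y\<^sup>2))"
proof (induction k)
  case 0
  then show ?case by (simp add: one_complex.code)
next
  case (Suc k)
  then show ?case by (simp add: complex_eq_iff power2_eq_square algebra_simps)
qed

lemma power_fueter_chain: "fueter_chain UNIV (power_re k) (power_im k)"
proof (induction k)
  case 0
  have "power_re 0 n = (\<lambda>w. if n = 0 then 1 else 0)" "power_im 0 n = (\<lambda>w. 0)" for n
    by auto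
  then show ?case by (simp add: fueter_chain_def)
next
  case (Suc k)
  note D = fueter_chainD[OF Suc UNIV_I]
  have eq: "power_re (Suc k) n = (\<lambda>w. fst w * power_re k n w - snd w * power_im k n w
     - 2 * real n * power_im k (n - 1) w)"
    "power_im (Suc k) n = (\<lambda>w. fst w * power_im k n w + power_re k n w)" for n
    by auto
  show ?case
    unfolding fueter_chain_def
  proof (intro allI ballI conjI)
    fix n w
    have shift: "((\<lambda>w. real n * power_im k (n - 1) w) has_derivative
       (\<lambda>h. - real n * fst h * power_re k n w + real n * snd h * (power_im k n w / 2))) (at w)"
    proof (cases n)
      case (Suc l)
      then show ?thesis
        using has_derivative_mult_right[OF D(2)[of l w], of "real n"]
        by (simp add: algebra_simps)
    qed simp
    have re: "((\<lambda>w. (fst w * power_re k n w - snd w * power_im k n w)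
       - 2 * (real n * power_im k (n - 1) w)) has_derivative
      (\<lambda>h. fst h * ((2 * real n + 1) * power_im (Suc k) n w + snd w * power_im (Suc k) (Suc n) w)
       + snd h * (power_re (Suc k) (Suc n) w / 2))) (at w)"
      by (rule has_derivative_eq_rhs[OF has_derivative_diff[OF has_derivative_diff[OF
            has_derivative_mult[OF has_derivative_fst[OF has_derivative_ident] D(1)]
            has_derivative_mult[OF has_derivative_snd[OF has_derivative_ident] D(2)]]
            has_derivative_mult_right[OF shift]]])
        (simp add: fun_eq_iff field_simps)
    then show "(power_re (Suc k) n has_derivative
      (\<lambda>h. fst h * ((2 * real n + 1) * power_im (Suc k) n w + snd w * power_im (Suc k) (Suc n) w)
       + snd h * (power_re (Suc k) (Suc n) w / 2))) (at w)"
      by (simp only: eq mult.assoc)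
    show "(power_im (Suc k) n has_derivative
      (\<lambda>h. - fst h * power_re (Suc k) (Suc n) w + snd h * (power_im (Suc k) (Suc n) w / 2))) (at w)"
      unfolding eq(2)[of n]
      by (rule has_derivative_eq_rhs[OF has_derivative_add[OF
            has_derivative_mult[OF has_derivative_fst[OF has_derivative_ident] D(2)] D(1)]])
        (simp add: fun_eq_iff field_simps)
  qed
qed

text \<open>A bound that is geometric in \<open>k\<close>, locally uniformly and at each level \<open>n\<close>, is what makes the
  chains of the powers summable against the Taylor coefficients of any entire function.\<close>

lemma power_re_im_bound:
  assumes "\<bar>fst w\<bar> \<le> B" "\<bar>snd w\<bar> \<le> B" "1 \<le> B"
  shows "\<bar>power_re k n w\<bar> \<le> (2 * B + 2 * real n) ^ k"
    and "\<bar>power_im k n w\<bar> \<le> (2 * B + 2 * real n) ^ k"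
proof -
  have "\<bar>power_re k n w\<bar> \<le> (2 * B + 2 * real n) ^ k \<and> \<bar>power_im k n w\<bar> \<le> (2 * B + 2 * real n) ^ k"
  proof (induction k arbitrary: n)
    case 0
    then show ?case by simp
  next
    case (Suc k)
    define W where "W = (2 * B + 2 * real n) ^ k"
    have W: "0 \<le> W" using assms by (simp add: W_def)
    have a: "\<bar>fst w * power_re k n w\<bar> \<le> B * W" "\<bar>fst w * power_im k n w\<bar> \<le> B * W"
      "\<bar>snd w * power_im k n w\<bar> \<le> B * W"
      using Suc[of n] assms unfolding abs_mult W_def by (auto intro!: mult_mono)
    have b: "\<bar>power_re k n w\<bar> \<le> B * W"
      using Suc[of n] mult_right_mono[OF \<open>1 \<le> B\<close> W] unfolding W_def by linarith
    have "\<bar>power_im k (n - 1) w\<bar> \<le> (2 * B + 2 * real (n - 1)) ^ k"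
      using Suc by blast
    also have "\<dots> \<le> W"
      unfolding W_def using assms by (intro power_mono) auto
    finally have c: "\<bar>2 * real n * power_im k (n - 1) w\<bar> \<le> 2 * real n * W"
      by (simp add: abs_mult mult_left_mono)
    have "(2 * B + 2 * real n) ^ Suc k = B * W + B * W + 2 * real n * W"
      by (simp add: W_def algebra_simps)
    moreover have "0 \<le> 2 * real n * W" using W by simp
    ultimately show ?case
      using a b c by (simp only: power_re.simps power_im.simps) linarith
  qed
  then show "\<bar>power_re k n w\<bar> \<le> (2 * B + 2 * real n) ^ k"
    and "\<bar>power_im k n w\<bar> \<le> (2 * B + 2 * real n) ^ k" by auto
qed

section \<open>Sums of chains\<close>

lemma has_derivative_suminf:
  fixes f :: "nat \<Rightarrow> 'a::real_normed_vector \<Rightarrow> 'b::banach"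
  assumes "open S" "convex S" "w \<in> S"
    and D: "\<And>j x. x \<in> S \<Longrightarrow> (f j has_derivative f' j x) (at x)"
    and bound: "\<And>j x h. x \<in> S \<Longrightarrow> norm (f' j x h) \<le> M j * norm h" and "summable M"
    and summable: "\<And>x. x \<in> S \<Longrightarrow> summable (\<lambda>j. f j x)"
  shows "((\<lambda>x. \<Sum>j. f j x) has_derivative (\<lambda>h. \<Sum>j. f' j w h)) (at w)"
proof -
  have sf': "summable (\<lambda>j. f' j x h)" if "x \<in> S" for x h
    by (rule summable_comparison_test'[where N = 0, OF summable_mult2[OF \<open>summable M\<close>, of "norm h"]])
      (simp add: bound that)
  have "\<exists>g. \<forall>x\<in>S. (\<lambda>j. f j x) sums g x \<and> (g has_derivative (\<lambda>h. \<Sum>j. f' j x h)) (at x within S)"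
  proof (rule has_derivative_series[OF \<open>convex S\<close>])
    show "(f j has_derivative f' j x) (at x within S)" if "x \<in> S" for j x
      using D[OF that] by (rule has_derivative_at_withinI)
    show "(\<lambda>j. f j w) sums (\<Sum>j. f j w)" "w \<in> S"
      using summable \<open>w \<in> S\<close> by (auto intro: summable_sums)
    fix e :: real assume e: "0 < e"
    have "(\<lambda>n. \<Sum>j. M (j + n)) \<longlonglongrightarrow> 0"
      using \<open>summable M\<close> by (rule suminf_exist_split2)
    then have "\<forall>\<^sub>F n in sequentially. (\<Sum>j. M (j + n)) < e"
      using e by (rule order_tendstoD)
    then show "\<forall>\<^sub>F n in sequentially. \<forall>x\<in>S. \<forall>h.
        norm ((\<Sum>i<n. f' i x h) - (\<Sum>j. f' j x h)) \<le> e * norm h"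
    proof (rule eventually_mono, intro ballI allI)
      fix n x h assume n: "(\<Sum>j. M (j + n)) < e" and x: "x \<in> S"
      have "norm ((\<Sum>i<n. f' i x h) - (\<Sum>j. f' j x h)) = norm (\<Sum>j. f' (j + n) x h)"
        using suminf_split_initial_segment[OF sf'[OF x, of h], of n]
        by (simp add: norm_minus_commute)
      also have "\<dots> \<le> (\<Sum>j. M (j + n) * norm h)"
        using \<open>summable M\<close>
        by (intro norm_suminf_le summable_mult2 bound[OF x])
         (simp add: summable_iff_shift)
      also have "\<dots> = (\<Sum>j. M (j + n)) * norm h"
        using \<open>summable M\<close> by (intro suminf_mult2[symmetric]) (simp add: summable_iff_shift)
      also have "\<dots> \<le> e * norm h"
        using n by (intro mult_right_mono) auto
      finally show "norm ((\<Sum>i<n. f' i x h) - (\<Sum>j. f' j x h)) \<le> e * norm h" .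
    qed
  qed
  then obtain g where g: "\<And>x. x \<in> S \<Longrightarrow> (\<lambda>j. f j x) sums g x"
    "\<And>x. x \<in> S \<Longrightarrow> (g has_derivative (\<lambda>h. \<Sum>j. f' j x h)) (at x within S)"
    by blast
  have "(g has_derivative (\<lambda>h. \<Sum>j. f' j w h)) (at w)"
    using g(2)[OF \<open>w \<in> S\<close>] at_within_open[OF \<open>w \<in> S\<close> \<open>open S\<close>] by simp
  then show ?thesis
    by (rule has_derivative_transform_within_open[OF _ \<open>open S\<close> \<open>w \<in> S\<close>])
      (use g(1) in \<open>auto simp: sums_iff\<close>)
qed

text \<open>Locally uniform summability at every level suffices, since the first derivatives at level \<open>n\<close>
  are themselves combinations of the levels \<open>n\<close> and \<open>n + 1\<close>.\<close>

lemma fueter_chain_suminf: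
  assumes chain: "\<And>j. fueter_chain UNIV (U j) (V j)"
    and bound: "\<And>B n. \<exists>M. summable M \<and> (\<forall>j w. \<bar>fst w\<bar> \<le> B \<longrightarrow> \<bar>snd w\<bar> \<le> B \<longrightarrow>
      \<bar>U j n w\<bar> \<le> M j \<and> \<bar>V j n w\<bar> \<le> M j)"
  shows "fueter_chain UNIV (\<lambda>n w. \<Sum>j. U j n w) (\<lambda>n w. \<Sum>j. V j n w)"
  unfolding fueter_chain_def
proof (intro allI ballI)
  fix n and w :: "real \<times> real"
  define B where "B = norm w + 1"
  define S :: "(real \<times> real) set" where "S = ball 0 B"
  have S: "open S" "convex S" "w \<in> S" by (auto simp: S_def B_def)
  have SB: "\<bar>fst x\<bar> \<le> B" "\<bar>snd x\<bar> \<le> B" if "x \<in> S" for x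
    using that norm_fst_le[of "fst x" "snd x"] norm_snd_le[of "snd x" "fst x"] by (auto simp: S_def)
  have ex: "\<exists>M. summable M \<and> (\<forall>j. \<forall>x\<in>S. \<bar>U j k x\<bar> \<le> M j \<and> \<bar>V j k x\<bar> \<le> M j)" for k
  proof -
    obtain M where "summable M" "\<And>j w. \<bar>fst w\<bar> \<le> B \<Longrightarrow> \<bar>snd w\<bar> \<le> B \<Longrightarrow>
        \<bar>U j k w\<bar> \<le> M j \<and> \<bar>V j k w\<bar> \<le> M j"
      using bound[of B k] by metis
    then show ?thesis using SB by (intro exI[of _ M]) simp
  qed
  have sum: "summable (\<lambda>j. U j k x)" "summable (\<lambda>j. V j k x)" if "x \<in> S" for k x
  proof -
    obtain M where "summable M" "\<forall>j. \<forall>x\<in>S. \<bar>U j k x\<bar> \<le> M j \<and> \<bar>V j k x\<bar> \<le> M j"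
      using ex[of k] by blast
    then show "summable (\<lambda>j. U j k x)" "summable (\<lambda>j. V j k x)"
      using that by (auto intro!: summable_comparison_test'[where N = 0 and g = M])
  qed
  obtain M where M: "summable M" "\<And>j x. x \<in> S \<Longrightarrow> \<bar>U j n x\<bar> \<le> M j \<and> \<bar>V j n x\<bar> \<le> M j"
    using ex[of n] by blast
  obtain M' where M': "summable M'"
    "\<And>j x. x \<in> S \<Longrightarrow> \<bar>U j (Suc n) x\<bar> \<le> M' j \<and> \<bar>V j (Suc n) x\<bar> \<le> M' j"
    using ex[of "Suc n"] by blast
  have h: "\<bar>fst h\<bar> \<le> norm h" "\<bar>snd h\<bar> \<le> norm h" for h :: "real \<times> real"
    using norm_fst_le[of "fst h" "snd h"] norm_snd_le[of "snd h" "fst h"] by auto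
  define c where "c = 2 * real n + 1"
  have c: "0 \<le> c" by (simp add: c_def)
  have bd: "norm (fst h * (c * V j n x + snd x * V j (Suc n) x) + snd h * (U j (Suc n) x / 2))
      \<le> (c * M j + B * M' j + M' j) * norm h" if "x \<in> S" for j x h
  proof -
    have "\<bar>c * V j n x + snd x * V j (Suc n) x\<bar> \<le> c * M j + B * M' j"
      using M(2)[OF that, of j] M'(2)[OF that, of j] c SB(2)[OF that]
      by (intro order_trans[OF abs_triangle_ineq] add_mono) (auto simp: abs_mult intro!: mult_mono)
    then have 1: "\<bar>fst h * (c * V j n x + snd x * V j (Suc n) x)\<bar> \<le> norm h * (c * M j + B * M' j)"
      unfolding abs_mult using h by (intro mult_mono) auto
    have 2: "\<bar>snd h * (U j (Suc n) x / 2)\<bar> \<le> norm h * M' j"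
      unfolding abs_mult using h M'(2)[OF that, of j] by (intro mult_mono) auto
    show ?thesis
      using abs_triangle_ineq[of "fst h * (c * V j n x + snd x * V j (Suc n) x)"
          "snd h * (U j (Suc n) x / 2)"] 1 2 by (simp add: algebra_simps)
  qed
  have bd': "norm (- fst h * U j (Suc n) x + snd h * (V j (Suc n) x / 2)) \<le> (2 * M' j) * norm h"
    if "x \<in> S" for j x h
  proof -
    have 1: "\<bar>- fst h * U j (Suc n) x\<bar> \<le> norm h * M' j"
      unfolding abs_mult using h M'(2)[OF that, of j] by (intro mult_mono) auto
    have 2: "\<bar>snd h * (V j (Suc n) x / 2)\<bar> \<le> norm h * M' j"
      unfolding abs_mult using h M'(2)[OF that, of j] by (intro mult_mono) auto
    show ?thesis
      using abs_triangle_ineq[of "- fst h * U j (Suc n) x" "snd h * (V j (Suc n) x / 2)"] 1 2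
      by (simp add: algebra_simps)
  qed
  have sums: "(\<lambda>j. U j k w) sums (\<Sum>j. U j k w)" "(\<lambda>j. V j k w) sums (\<Sum>j. V j k w)" for k
    by (intro summable_sums sum S(3))+
  have DU: "((\<lambda>w. \<Sum>j. U j n w) has_derivative (\<lambda>h. \<Sum>j. fst h * (c * V j n w
      + snd w * V j (Suc n) w) + snd h * (U j (Suc n) w / 2))) (at w)"
    using fueter_chainD(1)[OF chain UNIV_I] bd M(1) M'(1) sum(1)
    by (intro has_derivative_suminf[OF S, where M = "\<lambda>j. c * M j + B * M' j + M' j"])
      (auto simp: c_def intro!: summable_add summable_mult)
  have DV: "((\<lambda>w. \<Sum>j. V j n w) has_derivative
      (\<lambda>h. \<Sum>j. - fst h * U j (Suc n) w + snd h * (V j (Suc n) w / 2))) (at w)"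
    using fueter_chainD(2)[OF chain UNIV_I] bd' M'(1) sum(2)
    by (intro has_derivative_suminf[OF S, where M = "\<lambda>j. 2 * M' j"])
      (auto intro!: summable_mult)
  show "((\<lambda>w. \<Sum>j. U j n w) has_derivative
       (\<lambda>h. fst h * ((2 * real n + 1) * (\<Sum>j. V j n w) + snd w * (\<Sum>j. V j (Suc n) w))
         + snd h * ((\<Sum>j. U j (Suc n) w) / 2))) (at w) \<and>
    ((\<lambda>w. \<Sum>j. V j n w) has_derivative
       (\<lambda>h. - fst h * (\<Sum>j. U j (Suc n) w) + snd h * ((\<Sum>j. V j (Suc n) w) / 2))) (at w)"
    unfolding c_def[symmetric]
    by (intro conjI has_derivative_eq_rhs[OF DU] has_derivative_eq_rhs[OF DV] ext
        sums_unique[symmetric] sums_add sums_mult sums_divide sums)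
qed

section \<open>The chain of exp (z^2/2)/z\<close>

text \<open>The Laurent series \<open>exp (z\<^sup>2/2) / z = 1/z + z/2 + z\<^sup>3/8 + \<dots>\<close> splits off the entire function
  \<open>(exp (z\<^sup>2/2) - 1) / z\<close>. The constants with prefix \<open>regular\<close> belong to this entire part.\<close>

definition regular_coeff :: "nat \<Rightarrow> real" where
  "regular_coeff j = 1 / (2 ^ Suc j * fact (Suc j))"

definition regular_re :: "nat \<Rightarrow> real \<times> real \<Rightarrow> real" where
  "regular_re n w = (\<Sum>j. regular_coeff j * power_re (2 * j + 1) n w)"

definition regular_im :: "nat \<Rightarrow> real \<times> real \<Rightarrow> real" where
  "regular_im n w = (\<Sum>j. regular_coeff j * power_im (2 * j + 1) n w)"

lemma regular_coeff_sums:
  fixes z :: "'a::{real_normed_field,banach}"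
  assumes "z \<noteq> 0"
  shows "(\<lambda>j. of_real (regular_coeff j) * z ^ (2 * j + 1)) sums ((exp (z\<^sup>2 / 2) - 1) / z)"
proof -
  have "(\<lambda>j. (z\<^sup>2 / 2) ^ Suc j /\<^sub>R fact (Suc j)) sums (exp (z\<^sup>2 / 2) - 1)"
    using exp_converges[of "z\<^sup>2 / 2"] by (subst sums_Suc_iff) simp
  then have "(\<lambda>j. (z\<^sup>2 / 2) ^ Suc j /\<^sub>R fact (Suc j) / z) sums ((exp (z\<^sup>2 / 2) - 1) / z)"
    by (rule sums_divide)
  moreover have "(z\<^sup>2 / 2) ^ Suc j /\<^sub>R fact (Suc j) / z = of_real (regular_coeff j) * z ^ (2 * j + 1)" for j
  proof -
    have "(z\<^sup>2) ^ Suc j = z ^ (2 * j + 1) * z"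
      unfolding power_mult[symmetric] by simp
    then show ?thesis
      using assms unfolding power_divide
      by (simp add: regular_coeff_def scaleR_conv_of_real divide_inverse del: power_Suc fact_Suc)
  qed
  ultimately show ?thesis by simp
qed

text \<open>The dominating series is the entire part itself, evaluated at a real point \<open>\<rho>\<close>.\<close>

lemma regular_fueter_chain: "fueter_chain UNIV regular_re regular_im"
  unfolding regular_re_def[abs_def] regular_im_def[abs_def]
proof (rule fueter_chain_suminf)
  show "fueter_chain UNIV (\<lambda>n w. regular_coeff j * power_re (2 * j + 1) n w)
      (\<lambda>n w. regular_coeff j * power_im (2 * j + 1) n w)" for j
    by (rule fueter_chain_scale[OF power_fueter_chain])
  fix B :: real and n :: nat
  define D where "D = max B 1"
  define \<rho> where "\<rho> = 2 * D + 2 * real n"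
  have "\<rho> > 0" by (simp add: \<rho>_def D_def)
  show "\<exists>M. summable M \<and> (\<forall>j w. \<bar>fst w\<bar> \<le> B \<longrightarrow> \<bar>snd w\<bar> \<le> B \<longrightarrow>
      \<bar>regular_coeff j * power_re (2 * j + 1) n w\<bar> \<le> M j \<and> \<bar>regular_coeff j * power_im (2 * j + 1) n w\<bar> \<le> M j)"
  proof (intro exI[of _ "\<lambda>j. regular_coeff j * \<rho> ^ (2 * j + 1)"] conjI allI impI)
    show "summable (\<lambda>j. regular_coeff j * \<rho> ^ (2 * j + 1))"
      using regular_coeff_sums[of \<rho>] \<open>\<rho> > 0\<close> by (simp add: sums_iff)
    fix j and w :: "real \<times> real" assume "\<bar>fst w\<bar> \<le> B" "\<bar>snd w\<bar> \<le> B"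
    then have "\<bar>fst w\<bar> \<le> D" "\<bar>snd w\<bar> \<le> D" "1 \<le> D" by (auto simp: D_def)
    note b = power_re_im_bound[OF this, of "2 * j + 1" n, folded \<rho>_def]
    have "0 \<le> regular_coeff j" by (simp add: regular_coeff_def)
    then show "\<bar>regular_coeff j * power_re (2 * j + 1) n w\<bar> \<le> regular_coeff j * \<rho> ^ (2 * j + 1)"
      "\<bar>regular_coeff j * power_im (2 * j + 1) n w\<bar> \<le> regular_coeff j * \<rho> ^ (2 * j + 1)"
      unfolding abs_mult using b by (auto intro!: mult_left_mono)
  qed
qed

lemma regular_Complex:
  assumes "y \<noteq> 0"
  shows "(exp ((Complex x y)\<^sup>2 / 2) - 1) / Complex x y
    = Complex (regular_re 0 (x, y\<^sup>2)) (y * regular_im 0 (x, y\<^sup>2))"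
proof -
  let ?z = "Complex x y" and ?g = "(exp ((Complex x y)\<^sup>2 / 2) - 1) / Complex x y"
  have "?z \<noteq> 0" using assms by (simp add: complex_eq_iff)
  then have s: "(\<lambda>j. of_real (regular_coeff j) * ?z ^ (2 * j + 1)) sums ?g"
    by (rule regular_coeff_sums)
  have "(\<lambda>j. regular_coeff j * power_re (2 * j + 1) 0 (x, y\<^sup>2)) sums Re ?g"
    using sums_Re[OF s] unfolding power_re_im by simp
  moreover have "(\<lambda>j. regular_coeff j * (y * power_im (2 * j + 1) 0 (x, y\<^sup>2))) sums Im ?g"
    using sums_Im[OF s] unfolding power_re_im by simp
  then have "(\<lambda>j. regular_coeff j * (y * power_im (2 * j + 1) 0 (x, y\<^sup>2)) / y) sums (Im ?g / y)"
    by (rule sums_divide)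
  then have "(\<lambda>j. regular_coeff j * power_im (2 * j + 1) 0 (x, y\<^sup>2)) sums (Im ?g / y)"
    using assms by simp
  ultimately show ?thesis
    using assms by (simp add: complex_eq_iff regular_re_def regular_im_def sums_iff)
qed

definition gauss_re :: "nat \<Rightarrow> real \<times> real \<Rightarrow> real" where
  "gauss_re n w = inverse_re n w + regular_re n w"

definition gauss_im :: "nat \<Rightarrow> real \<times> real \<Rightarrow> real" where
  "gauss_im n w = inverse_im n w + regular_im n w"

lemma gauss_fueter_chain: "fueter_chain {w. 0 < snd w} gauss_re gauss_im"
  unfolding gauss_re_def[abs_def] gauss_im_def[abs_def]
  by (intro fueter_chain_add inverse_fueter_chain fueter_chain_subset[OF regular_fueter_chain]) auto

lemma gauss_Complex:
  assumes "y \<noteq> 0"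
  shows "exp ((Complex x y)\<^sup>2 / 2) / Complex x y
    = Complex (gauss_re 0 (x, y\<^sup>2)) (y * gauss_im 0 (x, y\<^sup>2))"
proof -
  have "exp ((Complex x y)\<^sup>2 / 2) / Complex x y
      = 1 / Complex x y + (exp ((Complex x y)\<^sup>2 / 2) - 1) / Complex x y"
    by (simp add: diff_divide_distrib)
  then show ?thesis
    unfolding inverse_Complex regular_Complex[OF assms]
    by (simp add: complex_eq_iff gauss_re_def gauss_im_def algebra_simps)
qed

lemma axial_extension_eq_axial:
  assumes "snd x \<noteq> 0"
    and "f (Complex (fst x) (norm (snd x))) = Complex (p (polar x)) (norm (snd x) * q (polar x))"
  shows "axial_extension f x = axial p q x"
  using assms by (simp add: axial_extension_def axial_def linear_cmul[OF cl_vector_linear])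

text \<open>Each of the \<open>n\<close> Laplacians contributes a factor \<open>m - 1 - 2 i\<close> with \<open>i < n\<close>, which is
  positive; this is why the constant in the decomposition does not vanish.\<close>

lemma Ft_gauss:
  fixes x :: "'m::{finite,linorder} point"
  assumes "CARD('m) = 2 * n + 1" "snd x \<noteq> 0"
  shows "Ft (\<lambda>z. exp (z\<^sup>2 / 2) / z) x
    = (\<Prod>i<n. 2 * real (n - i)) *\<^sub>R (axial (gauss_re n) (gauss_im n) x :: 'm clifford)"
proof -
  have "open {w :: real \<times> real. 0 < snd w}"
    by (intro open_Collect_less continuous_intros)
  then have "Ft (\<lambda>z. exp (z\<^sup>2 / 2) / z) x = (\<Prod>i<n. real CARD('m) - 1 - 2 * real i) *\<^sub>R
      (axial (gauss_re n) (gauss_im n) x :: 'm clifford)"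
    unfolding Ft_def assms(1)
    using laplacian_power_fueter_chain[OF gauss_fueter_chain, of
        "axial_extension (\<lambda>z. exp (z\<^sup>2 / 2) / z) :: 'm point \<Rightarrow> 'm clifford" x n] assms
    by (simp add: axial_extension_eq_axial gauss_Complex)
  also have "(\<Prod>i<n. real CARD('m) - 1 - 2 * real i) = (\<Prod>i<n. 2 * real (n - i))"
    by (intro prod.cong) (auto simp: assms of_nat_diff)
  finally show ?thesis .
qed

section \<open>Gaussian decay away from the real axis\<close>

text \<open>For \<open>f = exp (z\<^sup>2/2) / z\<close> one has \<open>D f = (i x/y - 1 - i/(y z)) f\<close> with \<open>D = (1/y) d/dy\<close>. The
  division by \<open>y\<close> turns the growing logarithmic derivative of \<open>f\<close> into a function that is bounded in
  the region \<open>\<bar>x\<bar> \<le> K\<close>, \<open>y \<ge> R\<close>. Its factors generate an algebra of functions that are all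
  bounded there and that \<open>D\<close> maps to itself, so that no power of \<open>y\<close> is ever lost against the
  Gaussian, however often \<open>D\<close> is applied.\<close>

inductive bounded_coeff :: "(real \<Rightarrow> real \<Rightarrow> complex) \<Rightarrow> bool" where
  const: "bounded_coeff (\<lambda>x y. c)"
| abscissa: "bounded_coeff (\<lambda>x y. of_real x)"
| inverse_ordinate: "bounded_coeff (\<lambda>x y. inverse (of_real y))"
| inverse_point: "bounded_coeff (\<lambda>x y. inverse (Complex x y))"
| add: "bounded_coeff b \<Longrightarrow> bounded_coeff b' \<Longrightarrow> bounded_coeff (\<lambda>x y. b x y + b' x y)"
| mult: "bounded_coeff b \<Longrightarrow> bounded_coeff b' \<Longrightarrow> bounded_coeff (\<lambda>x y. b x y * b' x y)"

lemma bounded_coeff_bounded: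
  assumes "bounded_coeff b" and "R > 0"
  shows "\<exists>C. \<forall>x y. \<bar>x\<bar> \<le> K \<longrightarrow> R \<le> y \<longrightarrow> norm (b x y) \<le> C"
  using assms(1)
proof induction
  case (const c)
  then show ?case by auto
next
  case abscissa
  then show ?case by auto
next
  case inverse_ordinate
  have "norm (inverse (complex_of_real y)) \<le> 1 / R" if "R \<le> y" for y
    using that \<open>R > 0\<close> by (simp add: norm_inverse divide_inverse)
  then show ?case by blast
next
  case inverse_point
  have "norm (inverse (Complex x y)) \<le> 1 / R" if "R \<le> y" for x y
  proof -
    have "R \<le> norm (Complex x y)"
      using that \<open>R > 0\<close> abs_Im_le_cmod[of "Complex x y"] by simp
    then show ?thesis
      using \<open>R > 0\<close> by (simp add: norm_inverse divide_inverse le_imp_inverse_le)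
  qed
  then show ?case by blast
next
  case (add b b')
  then obtain C C' where "\<forall>x y. \<bar>x\<bar> \<le> K \<longrightarrow> R \<le> y \<longrightarrow> norm (b x y) \<le> C"
    "\<forall>x y. \<bar>x\<bar> \<le> K \<longrightarrow> R \<le> y \<longrightarrow> norm (b' x y) \<le> C'" by blast
  then show ?case by (intro exI[of _ "C + C'"]) (auto intro!: norm_triangle_mono)
next
  case (mult b b')
  then obtain C C' where C: "\<forall>x y. \<bar>x\<bar> \<le> K \<longrightarrow> R \<le> y \<longrightarrow> norm (b x y) \<le> C"
    "\<forall>x y. \<bar>x\<bar> \<le> K \<longrightarrow> R \<le> y \<longrightarrow> norm (b' x y) \<le> C'" by blast
  have "norm (b x y * b' x y) \<le> C * C'" if "\<bar>x\<bar> \<le> K" "R \<le> y" for x y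
    unfolding norm_mult using C that order_trans[OF norm_ge_zero]
    by (intro mult_mono) blast+
  then show ?case by blast
qed

lemma Complex_has_vector_derivative: "((\<lambda>y. Complex x y) has_vector_derivative \<i>) (at y)"
proof -
  have "((\<lambda>y. of_real x + y *\<^sub>R \<i>) has_vector_derivative \<i>) (at y)"
    by (auto intro!: derivative_eq_intros)
  then show ?thesis by (simp add: Complex_eq scaleR_conv_of_real mult.commute)
qed

lemma bounded_coeff_derivative:
  assumes "bounded_coeff b"
  shows "\<exists>b'. bounded_coeff b' \<and>
    (\<forall>x y. 0 < y \<longrightarrow> ((\<lambda>y. b x y) has_vector_derivative of_real y * b' x y) (at y))"
  using assms
proof induction
  case (const c)
  show ?case by (rule exI[of _ "\<lambda>x y. 0"]) (auto intro: bounded_coeff.intros)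
next
  case abscissa
  show ?case by (rule exI[of _ "\<lambda>x y. 0"]) (auto intro: bounded_coeff.intros)
next
  case inverse_ordinate
  let ?p = "\<lambda>x y :: real. inverse (complex_of_real y)"
  have "((\<lambda>y. inverse (complex_of_real y)) has_vector_derivative
      of_real y * (- 1 * (?p x y * ?p x y * ?p x y))) (at y)" if "0 < y" for x y
    using field_vector_diff_chain_at[OF has_vector_derivative_of_real[OF
          DERIV_ident], OF DERIV_inverse, of y] that
    by (simp add: comp_def field_simps power2_eq_square)
  then show ?case
    by (intro exI[of _ "\<lambda>x y. - 1 * (?p x y * ?p x y * ?p x y)"] conjI bounded_coeff.intros) auto
next
  case inverse_point
  let ?q = "\<lambda>x y. inverse (Complex x y)" and ?p = "\<lambda>x y :: real. inverse (complex_of_real y)"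
  have "((\<lambda>y. ?q x y) has_vector_derivative
      of_real y * (- \<i> * (?q x y * ?q x y * ?p x y))) (at y)" if "0 < y" for x y
  proof -
    have "Complex x y \<noteq> 0" using that by (simp add: complex_eq_iff)
    then show ?thesis
      using field_vector_diff_chain_at[OF Complex_has_vector_derivative DERIV_inverse, of x y] that
      by (simp add: comp_def field_simps power2_eq_square)
  qed
  then show ?case
    by (intro exI[of _ "\<lambda>x y. - \<i> * (?q x y * ?q x y * ?p x y)"] conjI bounded_coeff.intros) auto
next
  case (add b c)
  then obtain b' c' where b': "bounded_coeff b'"
      "\<And>x y. 0 < y \<Longrightarrow> ((\<lambda>y. b x y) has_vector_derivative of_real y * b' x y) (at y)"
    and c': "bounded_coeff c'"
      "\<And>x y. 0 < y \<Longrightarrow> ((\<lambda>y. c x y) has_vector_derivative of_real y * c' x y) (at y)"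
    by blast
  have "((\<lambda>y. b x y + c x y) has_vector_derivative of_real y * (b' x y + c' x y)) (at y)"
    if "0 < y" for x y
    using has_vector_derivative_add[OF b'(2)[OF that] c'(2)[OF that]] by (simp add: algebra_simps)
  then show ?case
    by (intro exI[of _ "\<lambda>x y. b' x y + c' x y"] conjI allI impI bounded_coeff.add b'(1) c'(1))
next
  case (mult b c)
  then obtain b' c' where b': "bounded_coeff b'"
      "\<And>x y. 0 < y \<Longrightarrow> ((\<lambda>y. b x y) has_vector_derivative of_real y * b' x y) (at y)"
    and c': "bounded_coeff c'"
      "\<And>x y. 0 < y \<Longrightarrow> ((\<lambda>y. c x y) has_vector_derivative of_real y * c' x y) (at y)"
    by blast
  have "((\<lambda>y. b x y * c x y) has_vector_derivative
      of_real y * (b x y * c' x y + b' x y * c x y)) (at y)" if "0 < y" for x y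
    using has_vector_derivative_mult[OF b'(2)[OF that] c'(2)[OF that]] by (simp add: algebra_simps)
  then show ?case
    by (intro exI[of _ "\<lambda>x y. b x y * c' x y + b' x y * c x y"] conjI allI impI
        bounded_coeff.add bounded_coeff.mult mult.hyps b'(1) c'(1))
qed

text \<open>The function \<open>\<phi>\<close> is left arbitrary because two instances occur: \<open>f\<close> itself, for the scalar part
  of an axial function, and \<open>- i f / y\<close>, whose real part is \<open>v / y\<close>, for the vector part. The latter
  keeps the factor \<open>1/y\<close> that compensates the length \<open>r\<close> of the vector.\<close>

lemma iterated_radial_derivative_form:
  assumes \<phi>: "\<And>x y. 0 < y \<Longrightarrow> ((\<lambda>y. \<phi> x y) has_vector_derivative of_real y * (d x y * \<phi> x y)) (at y)"
    and "bounded_coeff d"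
    and U: "\<And>n x y. 0 < y \<Longrightarrow> ((\<lambda>y. U n (x, y\<^sup>2)) has_real_derivative y * U (Suc n) (x, y\<^sup>2)) (at y)"
    and U0: "\<And>x y. 0 < y \<Longrightarrow> U 0 (x, y\<^sup>2) = Re (\<phi> x y)"
  shows "\<exists>b. bounded_coeff b \<and> (\<forall>x y. 0 < y \<longrightarrow> U n (x, y\<^sup>2) = Re (b x y * \<phi> x y))"
proof (induction n)
  case 0
  show ?case by (rule exI[of _ "\<lambda>x y. 1"]) (auto intro: bounded_coeff.const simp: U0)
next
  case (Suc n)
  then obtain b where b: "bounded_coeff b" "\<And>x y. 0 < y \<Longrightarrow> U n (x, y\<^sup>2) = Re (b x y * \<phi> x y)"
    by blast
  obtain b' where b': "bounded_coeff b'"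
    "\<And>x y. 0 < y \<Longrightarrow> ((\<lambda>y. b x y) has_vector_derivative of_real y * b' x y) (at y)"
    using bounded_coeff_derivative[OF b(1)] by blast
  have "U (Suc n) (x, y\<^sup>2) = Re ((b x y * d x y + b' x y) * \<phi> x y)" if "0 < y" for x y
  proof -
    have "((\<lambda>y. b x y * \<phi> x y) has_vector_derivative
        of_real y * ((b x y * d x y + b' x y) * \<phi> x y)) (at y)"
      using has_vector_derivative_mult[OF b'(2)[OF that] \<phi>[OF that]] by (simp add: algebra_simps)
    then have "((\<lambda>y. Re (b x y * \<phi> x y)) has_vector_derivative
        Re (of_real y * ((b x y * d x y + b' x y) * \<phi> x y))) (at y)"
      by (rule bounded_linear.has_vector_derivative[OF bounded_linear_Re])
    then have "((\<lambda>y. U n (x, y\<^sup>2)) has_vector_derivative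
        Re (of_real y * ((b x y * d x y + b' x y) * \<phi> x y))) (at y)"
      by (rule has_vector_derivative_transform_within_open[where S = "{0<..}"])
        (use that b(2) in auto)
    moreover have "((\<lambda>y. U n (x, y\<^sup>2)) has_vector_derivative y * U (Suc n) (x, y\<^sup>2)) (at y)"
      using U[OF that] by (simp add: has_real_derivative_iff_has_vector_derivative)
    ultimately have "y * U (Suc n) (x, y\<^sup>2) = Re (of_real y * ((b x y * d x y + b' x y) * \<phi> x y))"
      by (rule vector_derivative_unique_at[rotated])
    then show ?thesis
      using that unfolding scaleR_conv_of_real[symmetric] by simp
  qed
  then show ?case
    by (intro exI[of _ "\<lambda>x y. b x y * d x y + b' x y"] conjI allI impI
        bounded_coeff.add bounded_coeff.mult b(1) b'(1) \<open>bounded_coeff d\<close>)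
qed

lemma fueter_chain_radial_derivative:
  assumes "fueter_chain {w. 0 < snd w} U V" "0 < y"
  shows "((\<lambda>y. U n (x, y\<^sup>2)) has_real_derivative y * U (Suc n) (x, y\<^sup>2)) (at y)"
    and "((\<lambda>y. V n (x, y\<^sup>2)) has_real_derivative y * V (Suc n) (x, y\<^sup>2)) (at y)"
proof -
  have w: "(x, y\<^sup>2) \<in> {w. 0 < snd w}" using assms(2) by simp
  have P: "((\<lambda>y. (x, y\<^sup>2)) has_derivative (\<lambda>h. (0, 2 * y * h))) (at y)"
    by (auto intro!: derivative_eq_intros)
  show "((\<lambda>y. U n (x, y\<^sup>2)) has_real_derivative y * U (Suc n) (x, y\<^sup>2)) (at y)"
    unfolding has_field_derivative_def
    using diff_chain_at[OF P fueter_chainD(1)[OF assms(1) w, of n], unfolded comp_def]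
    by (rule has_derivative_eq_rhs) (simp add: fun_eq_iff)
  show "((\<lambda>y. V n (x, y\<^sup>2)) has_real_derivative y * V (Suc n) (x, y\<^sup>2)) (at y)"
    unfolding has_field_derivative_def
    using diff_chain_at[OF P fueter_chainD(2)[OF assms(1) w, of n], unfolded comp_def]
    by (rule has_derivative_eq_rhs) (simp add: fun_eq_iff)
qed

lemma gauss_radial_derivative:
  assumes "0 < y"
  shows "((\<lambda>y. exp ((Complex x y)\<^sup>2 / 2) / Complex x y) has_vector_derivative
    of_real y * ((\<i> * of_real x * inverse (of_real y) + (- 1 - \<i> * (inverse (of_real y) * inverse (Complex x y))))
      * (exp ((Complex x y)\<^sup>2 / 2) / Complex x y))) (at y)"
proof -
  define z where "z = Complex x y"
  have z: "z \<noteq> 0" using assms by (simp add: z_def complex_eq_iff)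
  have "((\<lambda>z. exp (z\<^sup>2 / 2) / z) has_field_derivative (z - 1 / z) * (exp (z\<^sup>2 / 2) / z)) (at z)"
    using z by (auto intro!: derivative_eq_intros simp: field_simps power2_eq_square)
  from field_vector_diff_chain_at[OF Complex_has_vector_derivative this[unfolded z_def]]
  have "((\<lambda>y. exp ((Complex x y)\<^sup>2 / 2) / Complex x y) has_vector_derivative
     \<i> * ((z - 1 / z) * (exp (z\<^sup>2 / 2) / z))) (at y)"
    by (simp add: comp_def z_def)
  moreover have "\<i> * (z - 1 / z) = of_real y * (\<i> * of_real x * inverse (of_real y)
      + (- 1 - \<i> * (inverse (of_real y) * inverse z)))"
  proof -
    have "z = of_real x + \<i> * of_real y" by (simp add: z_def Complex_eq)
    then have "\<i> * (z - 1 / z) = \<i> * of_real x - of_real y - \<i> * inverse z"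
      by (simp add: algebra_simps divide_inverse)
    moreover have "of_real y * inverse (of_real y) = (1 :: complex)"
      using assms by simp
    ultimately show ?thesis by algebra
  qed
  ultimately show ?thesis
    by (simp only: z_def mult.assoc[symmetric])
qed

text \<open>On a strip the factor \<open>exp (x\<^sup>2/2)\<close> is bounded, and \<open>1/z\<close> is bounded above the height \<open>R\<close>.\<close>

lemma norm_gauss_le:
  assumes "\<bar>x\<bar> \<le> K" "0 < R" "R \<le> y"
  shows "norm (exp ((Complex x y)\<^sup>2 / 2) / Complex x y) \<le> exp (K\<^sup>2 / 2) / R * exp (- y\<^sup>2 / 2)"
proof -
  have "Re ((Complex x y)\<^sup>2 / 2) = x\<^sup>2 / 2 + - y\<^sup>2 / 2"
    by (simp add: power2_eq_square diff_divide_distrib)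
  then have "norm (exp ((Complex x y)\<^sup>2 / 2)) = exp (x\<^sup>2 / 2) * exp (- y\<^sup>2 / 2)"
    unfolding norm_exp_eq_Re exp_add[symmetric] by (rule arg_cong)
  also have "\<dots> \<le> exp (K\<^sup>2 / 2) * exp (- y\<^sup>2 / 2)"
    using assms(1) abs_le_square_iff[of x K] by simp
  finally have "norm (exp ((Complex x y)\<^sup>2 / 2)) \<le> exp (K\<^sup>2 / 2) * exp (- y\<^sup>2 / 2)" .
  moreover have "R \<le> norm (Complex x y)"
    using assms abs_Im_le_cmod[of "Complex x y"] by simp
  ultimately have "norm (exp ((Complex x y)\<^sup>2 / 2)) / norm (Complex x y)
      \<le> (exp (K\<^sup>2 / 2) * exp (- y\<^sup>2 / 2)) / R"
    using assms by (intro frac_le) auto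
  then show ?thesis by (simp add: norm_divide)
qed

lemma gauss_chain_bound:
  assumes "R > 0"
  shows "\<exists>C. \<forall>x y. \<bar>x\<bar> \<le> K \<longrightarrow> R \<le> y \<longrightarrow>
    \<bar>gauss_re n (x, y\<^sup>2)\<bar> \<le> C * exp (- y\<^sup>2 / 2) \<and> y * \<bar>gauss_im n (x, y\<^sup>2)\<bar> \<le> C * exp (- y\<^sup>2 / 2)"
proof -
  define f where "f x y = exp ((Complex x y)\<^sup>2 / 2) / Complex x y" for x y
  define p where "p = (\<lambda>(x :: real) (y :: real). inverse (complex_of_real y))"
  define d where "d = (\<lambda>x y. \<i> * of_real x * p x y + (- 1 + - \<i> * (p x y * inverse (Complex x y))))"
  have bp: "bounded_coeff p"
    unfolding p_def by (rule bounded_coeff.intros)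
  have bd: "bounded_coeff d"
    unfolding d_def by (intro bounded_coeff.intros bp)
  have f': "((\<lambda>y. f x y) has_vector_derivative of_real y * (d x y * f x y)) (at y)" if "0 < y" for x y
    using gauss_radial_derivative[OF that, of x] by (simp add: f_def d_def p_def)
  note chain = fueter_chain_radial_derivative[OF gauss_fueter_chain]
  have f0: "gauss_re 0 (x, y\<^sup>2) = Re (f x y)" if "0 < y" for x y
    using that by (simp add: f_def gauss_Complex)
  obtain b where b: "bounded_coeff b" "\<And>x y. 0 < y \<Longrightarrow> gauss_re n (x, y\<^sup>2) = Re (b x y * f x y)"
    using iterated_radial_derivative_form[of f d gauss_re n, OF f' bd chain(1) f0] by blast
  \<comment> \<open>The factor \<open>p = 1/y\<close> satisfies \<open>D p = - p\<^sup>3\<close>, so the logarithmic derivative changes by \<open>- p\<^sup>2\<close>.\<close>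
  have g': "((\<lambda>y. - \<i> * p x y * f x y) has_vector_derivative
      of_real y * ((- 1 * (p x y * p x y) + d x y) * (- \<i> * p x y * f x y))) (at y)" if "0 < y" for x y
  proof -
    have "((\<lambda>y. inverse (complex_of_real y)) has_vector_derivative
        - (inverse (of_real y))\<^sup>2) (at y)"
      using field_vector_diff_chain_at[OF has_vector_derivative_of_real[OF DERIV_ident],
          OF DERIV_inverse, of y] that
      by (simp add: comp_def numeral_2_eq_2)
    then have "((\<lambda>y. - \<i> * (p x y * f x y)) has_vector_derivative
        (- \<i> * (p x y * (of_real y * (d x y * f x y)) + (- (p x y)\<^sup>2) * f x y))) (at y)"
      unfolding p_def
      by (intro has_vector_derivative_mult_right has_vector_derivative_mult f' that)
    then have "((\<lambda>y. - \<i> * p x y * f x y) has_vector_derivative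
        (- \<i> * (p x y * (of_real y * (d x y * f x y)) + (- (p x y)\<^sup>2) * f x y))) (at y)"
      by (simp only: mult.assoc)
    then show ?thesis
    proof (rule has_vector_derivative_eq_rhs)
      have "p x y * of_real y = 1" using that by (simp add: p_def)
      then show "- \<i> * (p x y * (of_real y * (d x y * f x y)) + (- (p x y)\<^sup>2) * f x y)
          = of_real y * ((- 1 * (p x y * p x y) + d x y) * (- \<i> * p x y * f x y))"
        by algebra
    qed
  qed
  have g0: "gauss_im 0 (x, y\<^sup>2) = Re (- \<i> * p x y * f x y)" if "0 < y" for x y
    using that by (simp add: f_def gauss_Complex p_def of_real_inverse[symmetric] del: of_real_inverse)
  have bg: "bounded_coeff (\<lambda>x y. - 1 * (p x y * p x y) + d x y)"
    by (intro bounded_coeff.add bounded_coeff.mult bounded_coeff.const bp bd)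
  obtain b' where b': "bounded_coeff b'"
    "\<And>x y. 0 < y \<Longrightarrow> gauss_im n (x, y\<^sup>2) = Re (b' x y * (- \<i> * p x y * f x y))"
    using iterated_radial_derivative_form[of "\<lambda>x y. - \<i> * p x y * f x y" "\<lambda>x y. - 1 * (p x y * p x y) + d x y"
        gauss_im n, OF g' bg chain(2) g0]
    by blast
  obtain C C' where C: "\<And>x y. \<bar>x\<bar> \<le> K \<Longrightarrow> R \<le> y \<Longrightarrow> norm (b x y) \<le> C"
    and C': "\<And>x y. \<bar>x\<bar> \<le> K \<Longrightarrow> R \<le> y \<Longrightarrow> norm (b' x y) \<le> C'"
    using bounded_coeff_bounded[OF b(1) assms, of K] bounded_coeff_bounded[OF b'(1) assms, of K]
    by blast
  define D where "D = max C C'"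
  define E where "E = exp (K\<^sup>2 / 2) / R"
  show ?thesis
  proof (intro exI[of _ "D * E"] allI impI conjI)
    fix x y assume xy: "\<bar>x\<bar> \<le> K" "R \<le> y"
    then have y: "0 < y" using assms by simp
    have f: "norm (f x y) \<le> E * exp (- y\<^sup>2 / 2)"
      unfolding f_def E_def using norm_gauss_le[OF xy(1) assms xy(2)] .
    have D: "norm (b x y) \<le> D" "norm (b' x y) \<le> D"
      using C[OF xy] C'[OF xy] by (auto simp: D_def)
    then have "0 \<le> D" using norm_ge_zero order_trans by blast
    have "\<bar>gauss_re n (x, y\<^sup>2)\<bar> \<le> norm (b x y) * norm (f x y)"
      unfolding b(2)[OF y] norm_mult[symmetric] by (rule abs_Re_le_cmod)
    also have "\<dots> \<le> D * (E * exp (- y\<^sup>2 / 2))"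
      using f D \<open>0 \<le> D\<close> by (intro mult_mono) auto
    finally show "\<bar>gauss_re n (x, y\<^sup>2)\<bar> \<le> D * E * exp (- y\<^sup>2 / 2)" by (simp only: mult.assoc)
    have "y * \<bar>gauss_im n (x, y\<^sup>2)\<bar> \<le> y * norm (b' x y * (- \<i> * p x y * f x y))"
      unfolding b'(2)[OF y] using y by (intro mult_left_mono abs_Re_le_cmod) auto
    also have "\<dots> = norm (b' x y) * norm (f x y)"
      using y by (simp add: norm_mult norm_inverse p_def)
    also have "\<dots> \<le> D * (E * exp (- y\<^sup>2 / 2))"
      using f D \<open>0 \<le> D\<close> by (intro mult_mono) auto
    finally show "y * \<bar>gauss_im n (x, y\<^sup>2)\<bar> \<le> D * E * exp (- y\<^sup>2 / 2)" by (simp only: mult.assoc)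
  qed
qed

section \<open>Decomposition and decay of the Fueter image\<close>

lemma norm_axial_le: "norm (axial p q x) \<le> \<bar>p (polar x)\<bar> + norm (snd x) * \<bar>q (polar x)\<bar>"
  unfolding axial_def
  by (rule order_trans[OF norm_triangle_ineq]) (simp add: norm_cl_one norm_cl_vector)

theorem proposition3:
  assumes "odd CARD('m::{finite,linorder})"
  shows "(\<exists>(c::real) (M :: 'm point \<Rightarrow> 'm clifford).
            c \<noteq> 0 \<and> two_sided_monogenic_on UNIV M \<and>
            (\<forall>x. snd x \<noteq> 0 \<longrightarrow>
               Ft (\<lambda>z. exp (z\<^sup>2 / 2) / z) x =
                 c *\<^sub>R ((1 / norm x ^ (CARD('m) + 1)) *\<^sub>R cl_cnj (paravector x) + M x))) \<and>
         (\<forall>K R :: real. K > 0 \<longrightarrow> R > 0 \<longrightarrow>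
            (\<exists>C>0. \<forall>(x0::real) (xv :: (real, 'm) vec). \<bar>x0\<bar> \<le> K \<longrightarrow> norm xv \<ge> R \<longrightarrow>
               norm (Ft (\<lambda>z. exp (z\<^sup>2 / 2) / z) (x0, xv)) \<le> C * exp (- (norm xv)\<^sup>2 / 2)))"
proof -
  obtain n where m: "CARD('m) = 2 * n + 1"
    using assms by (rule oddE)
  define c0 where "c0 = (\<Prod>i<n. 2 * real (n - i))"
  define c1 :: real where "c1 = (- 2) ^ n * fact n"
  have c: "c0 \<noteq> 0" "c1 \<noteq> 0" by (auto simp: c0_def c1_def)
  have Ft: "Ft (\<lambda>z. exp (z\<^sup>2 / 2) / z) x = c0 *\<^sub>R axial (gauss_re n) (gauss_im n) x"
    if "snd x \<noteq> 0" for x :: "'m point"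
    using Ft_gauss[OF m that] by (simp add: c0_def)
  \<comment> \<open>The constant \<open>c1\<close> from the Cauchy kernel is divided out, so that the kernel has coefficient 1.\<close>
  define M :: "'m point \<Rightarrow> 'm clifford" where
    "M = axial (\<lambda>w. inverse c1 * regular_re n w) (\<lambda>w. inverse c1 * regular_im n w)"
  have "two_sided_monogenic_on UNIV M"
    unfolding M_def
    by (rule fueter_chain_two_sided_monogenic[OF fueter_chain_scale[OF regular_fueter_chain] m])
  moreover have "Ft (\<lambda>z. exp (z\<^sup>2 / 2) / z) x
      = (c0 * c1) *\<^sub>R ((1 / norm x ^ (CARD('m) + 1)) *\<^sub>R cl_cnj (paravector x) + M x)"
    if "snd x \<noteq> 0" for x
  proof -
    have "axial (gauss_re n) (gauss_im n) x
        = axial (inverse_re n) (inverse_im n) x + axial (regular_re n) (regular_im n) x"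
      by (simp add: axial_add gauss_re_def[abs_def] gauss_im_def[abs_def])
    also have "\<dots> = c1 *\<^sub>R ((1 / norm x ^ (CARD('m) + 1)) *\<^sub>R cl_cnj (paravector x)) + c1 *\<^sub>R M x"
      using c by (simp add: axial_inverse[OF m] c1_def[symmetric] M_def axial_scale del: scaleR_scaleR)
        simp
    finally show ?thesis
      by (simp only: Ft[OF that] scaleR_add_right scaleR_scaleR mult.assoc)
  qed
  moreover have "\<exists>C>0. \<forall>x0 (xv :: (real, 'm) vec). \<bar>x0\<bar> \<le> K \<longrightarrow> norm xv \<ge> R \<longrightarrow>
      norm (Ft (\<lambda>z. exp (z\<^sup>2 / 2) / z) (x0, xv)) \<le> C * exp (- (norm xv)\<^sup>2 / 2)"
    if "R > 0" for K R :: real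
  proof -
    obtain C where C: "\<And>x y. \<bar>x\<bar> \<le> K \<Longrightarrow> R \<le> y \<Longrightarrow> \<bar>gauss_re n (x, y\<^sup>2)\<bar> \<le> C * exp (- y\<^sup>2 / 2)"
      "\<And>x y. \<bar>x\<bar> \<le> K \<Longrightarrow> R \<le> y \<Longrightarrow> y * \<bar>gauss_im n (x, y\<^sup>2)\<bar> \<le> C * exp (- y\<^sup>2 / 2)"
      using gauss_chain_bound[OF \<open>R > 0\<close>, of K n] by blast
    \<comment> \<open>The summand 1 makes the constant positive, since \<open>C\<close> may vanish or have any sign.\<close>
    define C' where "C' = \<bar>c0\<bar> * (2 * \<bar>C\<bar>) + 1"
    have "norm (Ft (\<lambda>z. exp (z\<^sup>2 / 2) / z) (x0, xv)) \<le> C' * exp (- (norm xv)\<^sup>2 / 2)"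
      if "\<bar>x0\<bar> \<le> K" "R \<le> norm xv" for x0 and xv :: "(real, 'm) vec"
    proof -
      have "xv \<noteq> 0" using that \<open>R > 0\<close> by auto
      then have "norm (Ft (\<lambda>z. exp (z\<^sup>2 / 2) / z) (x0, xv))
          = \<bar>c0\<bar> * norm (axial (gauss_re n) (gauss_im n) (x0, xv))"
        by (simp add: Ft)
      also have "\<dots> \<le> \<bar>c0\<bar> * (2 * C * exp (- (norm xv)\<^sup>2 / 2))"
        using C[OF that] norm_axial_le[of "gauss_re n" "gauss_im n" "(x0, xv)"]
        by (intro mult_left_mono) auto
      also have "\<dots> = \<bar>c0\<bar> * (2 * C) * exp (- (norm xv)\<^sup>2 / 2)"
        by simp
      also have "\<dots> \<le> C' * exp (- (norm xv)\<^sup>2 / 2)"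
        unfolding C'_def by (intro mult_right_mono add_increasing2 mult_left_mono) auto
      finally show ?thesis .
    qed
    moreover have "C' > 0" by (simp add: C'_def add_nonneg_pos)
    ultimately show ?thesis by blast
  qed
  moreover have "c0 * c1 \<noteq> 0" using c by simp
  ultimately show ?thesis by blast
qed

end
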